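(* Let $0<k<n$ be integers and let $p:\mathbb{R}^n\to\mathbb{R}^{n-1}$, $p(x_1,\dots,x_n)=(x_1,\dots,x_{n-1})$; $p$ restricts to an affine bijection from $\Delta_{k,n}$ onto $\tilde\Delta_{k,n}$. Then the following four collections of $(n-1)$-dimensional simplices in $\tilde\Delta_{k,n}$ coincide: (1) (Stanley) the closures of the sets $\psi^{-1}(\nabla_w)$, where $w$ ranges over permutations in $S_{n-1}$ whose inverse $w^{-1}$ has exactly $k-1$ descents; (2) (Sturmfels) the simplices $p(\nabla_{\mathcal I})$, where $\mathcal I=(I_1,\dots,I_n)$ ranges over maximal sorted collections of $k$-subsets of $[n]$; (3) (alcove) the alcoves contained in $\tilde\Delta_{k,n}$; (4) (circuit) the simplices $p(\Delta_c)$, where $c$ ranges over minimal circuits of the graph $G_{k,n}$.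
   Context: For $I\subseteq[n]=\{1,\dots,n\}$ with $|I|=k$, $\epsilon_I\in\mathbb{R}^n$ is the 0/1 vector with $\epsilon_i=1$ iff $i\in I$. The hypersimplex is $\Delta_{k,n}=\mathrm{conv}\{\epsilon_I: I\in\binom{[n]}{k}\}=\{x\in[0,1]^n: x_1+\dots+x_n=k\}$, and $\tilde\Delta_{k,n}=\{(x_1,\dots,x_{n-1})\in[0,1]^{n-1}: k-1\le x_1+\dots+x_{n-1}\le k\}$. Stanley's map: $\psi:[0,1]^{n-1}\to[0,1]^{n-1}$, $\psi(x)=(y_1,\dots,y_{n-1})$ with $y_i=(x_1+\dots+x_i)-\lfloor x_1+\dots+x_i\rfloor$. For $w\in S_{n-1}$, $\nabla_w=\{y\in[0,1]^{n-1}: 0<y_{w(1)}<y_{w(2)}<\dots<y_{w(n-1)}<1\}$. A descent of a permutation $u$ is an index $i$ with $u(i)>u(i+1)$. Sorting: for $k$-subsets $I,J$ of $[n]$ let $(a_1,\dots,a_{2k})$ be the nondecreasing ordering of the multiset union $I\cup J$, $U(I,J)=\{a_1,a_3,\dots,a_{2k-1}\}$, $V(I,J)=\{a_2,a_4,\dots,a_{2k}\}$. An ordered pair $(I,J)$ is sorted if $I=U(I,J)$ and $J=V(I,J)$; an ordered collection $(I_1,\dots,I_r)$ is sorted if $(I_i,I_j)$ is sorted for all $i<j$. $\nabla_{\mathcal I}=\mathrm{conv}\{\epsilon_{I_1},\dots,\epsilon_{I_r}\}$. Maximal (by inclusion) sorted collections have exactly $n$ elements. Alcoves: in coordinates $z_i=x_1+\dots+x_i$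 ($1\le i\le n-1$), $z_0=0$, on $\mathbb{R}^{n-1}$, consider the hyperplanes $H^l_{ij}=\{z_i-z_j=l\}$ for $0\le i<j\le n-1$, $l\in\mathbb{Z}$; alcoves are the closures of the connected components of the complement of their union (they are unit simplices). The graph $G_{k,n}$: vertices are the $\epsilon_I$, $I\in\binom{[n]}{k}$; indices are read modulo $n$ ($\epsilon_{n+1}=\epsilon_1$); there is a directed edge $\epsilon\xrightarrow{i}\epsilon'$ labelled $i\in[n]$ whenever $(\epsilon_i,\epsilon_{i+1})=(1,0)$ and $\epsilon'$ is obtained from $\epsilon$ by swapping $\epsilon_i$ and $\epsilon_{i+1}$ (a ``1'' moves cyclically one step right). A minimal circuit is a directed circuit of minimal possible length in $G_{k,n}$: starting from a vertex $\epsilon$, the first ``1'' moves step by step to the position of the second ``1'', the second to the position of the third, ..., and the last ``1'' moves cyclically to the original position of the first; it has length $n$ and its edge labels form a permutation of $[n]$. $\Delta_c$ is the convex hull of the $n$ vertices of the minimal circuit $c$. *)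

theory Defs
  imports
    "HOL-Analysis.Analysis"
    "HOL-Library.Function_Algebras"
    "HOL-Library.Multiset"
    "HOL-Combinatorics.Permutations"
    "Graph_Theory.Arc_Walk"
begin

text \<open>
  Both \<open>n\<close>-dimensional and \<open>(n - 1)\<close>-dimensional space occur for a variable \<open>n\<close>, so points are
  functions \<open>nat \<Rightarrow> real\<close> vanishing outside \<open>{1..m}\<close> (the coordinates are numbered from 1). The
  pointwise vector space structure makes the library notions \<open>convex hull\<close>,
  \<open>affine_dependent\<close> and \<open>linear\<close> available. The topology on functions is the product topology;
  \<open>coord_space m\<close> is closed in it and inherits the usual topology of Euclidean \<open>m\<close>-space, so that
  \<open>closure\<close> and \<open>components\<close> of its subsets are the usual ones.
\<close>

instantiation "fun" :: (type, scaleR) scaleR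
begin

definition scaleR_fun_def: "scaleR r f = (\<lambda>x. scaleR r (f x))"

instance ..

end

instance "fun" :: (type, real_vector) real_vector
  by standard (simp_all add: scaleR_fun_def fun_eq_iff scaleR_add_right scaleR_add_left)

definition coord_space :: "nat \<Rightarrow> (nat \<Rightarrow> real) set" where
  "coord_space m = {x. \<forall>i. i \<notin> {1..m} \<longrightarrow> x i = 0}"

definition unit_cube :: "nat \<Rightarrow> (nat \<Rightarrow> real) set" where
  "unit_cube m = {x \<in> coord_space m. \<forall>i\<in>{1..m}. 0 \<le> x i \<and> x i \<le> 1}"

definition drop_last_coord :: "nat \<Rightarrow> (nat \<Rightarrow> real) \<Rightarrow> (nat \<Rightarrow> real)" where
  "drop_last_coord n x = (\<lambda>i. if i \<in> {1..n - 1} then x i else 0)"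

text \<open>
  The definition of \<open>simplex\<close> in the theory \<open>Polytope\<close>, which is restricted there to the class
  \<open>euclidean_space\<close>.
\<close>

definition is_simplex :: "nat \<Rightarrow> (nat \<Rightarrow> real) set \<Rightarrow> bool" where
  "is_simplex d S \<longleftrightarrow>
     (\<exists>C. finite C \<and> \<not> affine_dependent C \<and> card C = d + 1 \<and> S = convex hull C)"


subsection \<open>Hypersimplices\<close>

definition k_subsets :: "nat \<Rightarrow> nat \<Rightarrow> nat set set" where
  "k_subsets k n = {I. I \<subseteq> {1..n} \<and> card I = k}"

definition eps :: "nat set \<Rightarrow> nat \<Rightarrow> real" where
  "eps I = indicator I"

definition hypersimplex :: "nat \<Rightarrow> nat \<Rightarrow> (nat \<Rightarrow> real) set" where
  "hypersimplex k n = convex hull (eps ` k_subsets k n)"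

definition proj_hypersimplex :: "nat \<Rightarrow> nat \<Rightarrow> (nat \<Rightarrow> real) set" where
  "proj_hypersimplex k n =
     {x \<in> unit_cube (n - 1). real k - 1 \<le> (\<Sum>i=1..n - 1. x i) \<and> (\<Sum>i=1..n - 1. x i) \<le> real k}"


subsection \<open>Stanley's triangulation\<close>

definition stanley_map :: "nat \<Rightarrow> (nat \<Rightarrow> real) \<Rightarrow> (nat \<Rightarrow> real)" where
  "stanley_map m x = (\<lambda>i. if i \<in> {1..m} then frac (\<Sum>j=1..i. x j) else 0)"

definition perm_region :: "nat \<Rightarrow> (nat \<Rightarrow> nat) \<Rightarrow> (nat \<Rightarrow> real) set" where
  "perm_region m w =
     {y \<in> unit_cube m. 0 < y (w 1) \<and> (\<forall>i\<in>{1..<m}. y (w i) < y (w (i + 1))) \<and> y (w m) < 1}"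

definition descents :: "nat \<Rightarrow> (nat \<Rightarrow> nat) \<Rightarrow> nat set" where
  "descents m u = {i \<in> {1..<m}. u i > u (i + 1)}"

definition stanley_simplices :: "nat \<Rightarrow> nat \<Rightarrow> (nat \<Rightarrow> real) set set" where
  "stanley_simplices k n =
     {closure {x \<in> unit_cube (n - 1). stanley_map (n - 1) x \<in> perm_region (n - 1) w} | w.
        w permutes {1..n - 1} \<and> card (descents (n - 1) (inv w)) = k - 1}"


subsection \<open>Sturmfels' triangulation\<close>

definition sorted_union :: "nat set \<Rightarrow> nat set \<Rightarrow> nat list" where
  "sorted_union I J = sorted_list_of_multiset (mset_set I + mset_set J)"

text \<open>
  List positions are numbered from 0, so \<open>a\<^sub>1, a\<^sub>3, \<dots>\<close> are the entries at even positions.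
\<close>

definition sort_U :: "nat set \<Rightarrow> nat set \<Rightarrow> nat set" where
  "sort_U I J = {sorted_union I J ! i | i. i < length (sorted_union I J) \<and> even i}"

definition sort_V :: "nat set \<Rightarrow> nat set \<Rightarrow> nat set" where
  "sort_V I J = {sorted_union I J ! i | i. i < length (sorted_union I J) \<and> odd i}"

definition sorted_pair :: "nat set \<Rightarrow> nat set \<Rightarrow> bool" where
  "sorted_pair I J \<longleftrightarrow> I = sort_U I J \<and> J = sort_V I J"

text \<open>
  Since every pair \<open>(I, I)\<close> is sorted, the members of a collection have to be required distinct.
\<close>

definition sorted_collection :: "nat \<Rightarrow> nat \<Rightarrow> nat set list \<Rightarrow> bool" where
  "sorted_collection k n Is \<longleftrightarrow>
     set Is \<subseteq> k_subsets k n \<and> distinct Is \<and>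
     (\<forall>i j. i < j \<and> j < length Is \<longrightarrow> sorted_pair (Is ! i) (Is ! j))"

definition maximal_sorted_collection :: "nat \<Rightarrow> nat \<Rightarrow> nat set list \<Rightarrow> bool" where
  "maximal_sorted_collection k n Is \<longleftrightarrow>
     sorted_collection k n Is \<and> \<not> (\<exists>Js. sorted_collection k n Js \<and> set Is \<subset> set Js)"

definition sturmfels_simplices :: "nat \<Rightarrow> nat \<Rightarrow> (nat \<Rightarrow> real) set set" where
  "sturmfels_simplices k n =
     {drop_last_coord n ` (convex hull (eps ` set Is)) | Is. maximal_sorted_collection k n Is}"


subsection \<open>Alcoves\<close>

definition z_coord :: "(nat \<Rightarrow> real) \<Rightarrow> nat \<Rightarrow> real" where
  "z_coord x i = (\<Sum>j=1..i. x j)"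

definition alcove_hyperplane :: "nat \<Rightarrow> nat \<Rightarrow> nat \<Rightarrow> int \<Rightarrow> (nat \<Rightarrow> real) set" where
  "alcove_hyperplane m i j l = {x \<in> coord_space m. z_coord x i - z_coord x j = of_int l}"

definition alcoves :: "nat \<Rightarrow> (nat \<Rightarrow> real) set set" where
  "alcoves m =
     closure ` components
       (coord_space m - \<Union>{alcove_hyperplane m i j l | i j l. i < j \<and> j \<le> m})"

definition alcove_simplices :: "nat \<Rightarrow> nat \<Rightarrow> (nat \<Rightarrow> real) set set" where
  "alcove_simplices k n = {A \<in> alcoves (n - 1). A \<subseteq> proj_hypersimplex k n}"


subsection \<open>The circuit triangulation\<close>

definition cyc_succ :: "nat \<Rightarrow> nat \<Rightarrow> nat" where
  "cyc_succ n i = (if i = n then 1 else i + 1)"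

text \<open>An arc \<open>(e, i, e')\<close> is an edge from \<open>e\<close> to \<open>e'\<close> with label \<open>i\<close>.\<close>

type_synonym labelled_arc = "(nat \<Rightarrow> real) \<times> nat \<times> (nat \<Rightarrow> real)"

definition circuit_graph :: "nat \<Rightarrow> nat \<Rightarrow> (nat \<Rightarrow> real, labelled_arc) pre_digraph" where
  "circuit_graph k n =
     \<lparr> verts = eps ` k_subsets k n,
       arcs = {(e, i, e').
         e \<in> eps ` k_subsets k n \<and> i \<in> {1..n} \<and> e i = 1 \<and> e (cyc_succ n i) = 0 \<and>
         e' = e(i := e (cyc_succ n i), cyc_succ n i := e i)},
       tail = (\<lambda>(e, i, e'). e),
       head = (\<lambda>(e, i, e'). e') \<rparr>"

definition minimal_circuit :: "nat \<Rightarrow> nat \<Rightarrow> labelled_arc list \<Rightarrow> bool" where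
  "minimal_circuit k n c \<longleftrightarrow> is_arg_min length (pre_digraph.cycle (circuit_graph k n)) c"

definition circuit_simplices :: "nat \<Rightarrow> nat \<Rightarrow> (nat \<Rightarrow> real) set set" where
  "circuit_simplices k n =
     {drop_last_coord n ` (convex hull (tail (circuit_graph k n) ` set c)) | c.
        minimal_circuit k n c}"

end

theory Submission
  imports Defs
begin

text \<open>
  Write \<open>n = m + 1\<close> and \<open>z\<^sub>i = x\<^sub>1 + \<dots> + x\<^sub>i\<close>. All four collections consist of the closed
  cells of the permutations \<open>w\<close> whose inverse has \<open>k - 1\<close> descents: on the cell of \<open>w\<close> the
  integer part of \<open>z\<^sub>i\<close> is the number of descents of \<open>w\<^sup>-\<^sup>1\<close> before \<open>i\<close>, and \<open>w\<close> lists the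
  indices by increasing fractional part of \<open>z\<^sub>i\<close>. The gaps between consecutive fractional parts
  are barycentric coordinates, so the cell is a simplex. On the unit cube the order of the
  fractional parts determines the integer parts, which gives Stanley's regions; the coordinates
  do not vanish off the hyperplanes \<open>z\<^sub>i - z\<^sub>j \<in> \<int>\<close>, which gives the alcoves. The cells cover the
  hypersimplex because any point is a limit of generic ones.

  A pair of \<open>k\<close>-subsets is sorted iff their counting functions \<open>i \<mapsto> |I \<inter> [i]|\<close> differ by 0
  or 1 everywhere, in the right direction. In a family of subsets that are pairwise sorted, in
  one order or the other, each barycentric coordinate therefore takes integer values that differ
  by at most 1. So a cell containing the centroid of the family contains the family, and as its
  only integral points are its vertices, the family consists of vertices of the cell. An arc with
  label \<open>i < n\<close> lowers the counting function at \<open>i\<close> by 1, and one with label \<open>n\<close> raises it by 1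
  on \<open>[m]\<close>; so a shortest circuit uses every label once, and any two of its vertices are joined
  by a walk with distinct labels, which makes them sorted in one order or the other.
\<close>

subsection \<open>Numbers and finite orders\<close>

lemma card_less_Suc_Collect: "card {t. t < Suc N \<and> P t} = card {t. t < N \<and> P t} + of_bool (P N)"
proof -
  have "{t. t < Suc N \<and> P t} = {t. t < N \<and> P t} \<union> (if P N then {N} else {})"
    by (auto simp: less_Suc_eq)
  then show ?thesis by simp
qed

lemma
  fixes N :: nat
  shows card_even_less: "card {t. t < N \<and> even t} = (N + 1) div 2"
    and card_odd_less: "card {t. t < N \<and> odd t} = N div 2"
  by (induction N) (simp_all add: card_less_Suc_Collect)

lemma sorted_nth_le_iff:
  fixes xs :: "'a::linorder list"
  assumes "sorted xs" "t < length xs"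
  shows "xs ! t \<le> a \<longleftrightarrow> t < length (filter (\<lambda>x. x \<le> a) xs)"
  using assms
proof (induction xs arbitrary: t)
  case (Cons x xs)
  show ?case
  proof (cases "x \<le> a")
    case True
    then show ?thesis using Cons by (cases t) auto
  next
    case False
    then have "filter (\<lambda>y. y \<le> a) (x # xs) = []"
      using Cons.prems by (auto simp: filter_empty_conv)
    moreover have "x \<le> (x # xs) ! t"
      using Cons.prems by (cases t) auto
    ultimately show ?thesis using False by auto
  qed
qed simp

lemma strict_mono_on_atMost_iff_Suc:
  fixes f :: "nat \<Rightarrow> 'a::preorder"
  shows "strict_mono_on {..m} f \<longleftrightarrow> (\<forall>s<m. f s < f (Suc s))"
proof
  assume step: "\<forall>s<m. f s < f (Suc s)"
  have "f r < f s" if "r < s" "s \<le> m" for r s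
    using that
  proof (induction s)
    case (Suc s)
    then have "f s < f (Suc s)" using step by simp
    then show ?case
      using Suc by (cases "r = s") (auto intro: less_trans)
  qed simp
  then show "strict_mono_on {..m} f"
    by (auto intro: strict_mono_onI)
qed (auto intro: strict_mono_onD)

lemma ex_permutes_strict_mono_on:
  fixes f :: "nat \<Rightarrow> 'a::linorder"
  assumes inj: "inj_on f {..m}" and least: "\<And>i. i \<le> m \<Longrightarrow> f 0 \<le> f i"
  obtains w where "w permutes {1..m}" "strict_mono_on {..m} (f \<circ> w)"
proof -
  define xs where "xs = sort_key f [0..<Suc m]"
  have xs: "distinct xs" "set xs = {..m}" "sorted (map f xs)" "length xs = Suc m"
    by (auto simp: xs_def simp del: upt_Suc)
  define w where "w s = (if s \<le> m then xs ! s else s)" for s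
  have "bij_betw ((!) xs) {..m} {..m}"
    using xs by (intro bij_betw_nth) (auto simp: lessThan_Suc_atMost)
  then have bij: "bij_betw w {..m} {..m}"
    by (rule bij_betw_cong[THEN iffD1, rotated]) (simp add: w_def)
  have mono: "strict_mono_on {..m} (f \<circ> w)"
  proof (rule strict_mono_onI)
    fix s t assume st: "s \<in> {..m}" "t \<in> {..m}" "s < t"
    then have "f (w s) \<le> f (w t)"
      using sorted_nth_mono[OF xs(3), of s t] xs(4) by (simp add: w_def)
    moreover have "f (w s) \<noteq> f (w t)"
      using st bij inj by (auto simp: bij_betw_def dest!: inj_onD)
    ultimately show "(f \<circ> w) s < (f \<circ> w) t" by simp
  qed
  obtain r where r: "r \<le> m" "w r = 0"
    using bij by (metis atMost_iff bij_betw_iff_bijections zero_le)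
  have "w 0 \<le> m"
    using bij_betwE[OF bij] by simp
  moreover from this have "f (w 0) = f 0"
    using strict_mono_on_leD[OF mono, of 0 r] r least[of "w 0"] by simp
  ultimately have "w 0 = 0"
    using inj_onD[OF inj] by simp
  have "w permutes {..m}"
    using bij by (rule bij_imp_permutes) (simp add: w_def)
  then have "w permutes {1..m}"
    by (rule permutes_superset) (use \<open>w 0 = 0\<close> in \<open>auto simp: not_less_eq_eq\<close>)
  then show ?thesis using mono that by blast
qed

lemma frac_eq_frac_iff: "frac x = frac y \<longleftrightarrow> x - y \<in> \<int>"
  by (metis frac_diff_eq frac_diff_zero frac_eq_0_iff)

lemma floor_add_if_frac_neq:
  fixes x y :: real
  assumes "0 \<le> y" "y \<le> 1" "frac (x + y) \<noteq> frac x"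
  shows "\<lfloor>x + y\<rfloor> = \<lfloor>x\<rfloor> + of_bool (frac (x + y) < frac x)"
proof -
  have "y \<noteq> 1"
    using assms(3) by (auto simp: frac_1_eq)
  then have "frac y = y"
    using assms(1,2) by (simp add: frac_eq)
  then show ?thesis
    using assms \<open>y \<noteq> 1\<close> frac_ge_0[of x] by (auto simp: floor_add frac_add floor_eq_iff)
qed

lemma nonneg_if_sum_nonneg_of_close_Ints:
  fixes f :: "'a \<Rightarrow> real"
  assumes "finite A" "a \<in> A"
    and Ints: "\<And>b. b \<in> A \<Longrightarrow> f b \<in> \<int>"
    and close: "\<And>b c. b \<in> A \<Longrightarrow> c \<in> A \<Longrightarrow> f b \<le> f c + 1"
    and sum: "0 \<le> (\<Sum>b\<in>A. f b)"
  shows "0 \<le> f a"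
proof (rule ccontr)
  assume "\<not> 0 \<le> f a"
  moreover obtain l where "f a = of_int l"
    using Ints[OF assms(2)] by (rule Ints_cases)
  ultimately have "f a \<le> -1"
    by simp
  then have "f b \<le> 0" if "b \<in> A" for b
    using close[OF that assms(2)] by linarith
  then have "(\<Sum>b\<in>A. f b) < (\<Sum>b\<in>A. 0)"
    using assms(1,2) \<open>f a \<le> -1\<close> by (intro sum_strict_mono_ex1 ballI bexI[of _ a]) auto
  then show False using sum by simp
qed

lemma countable_segment_Ints:
  fixes a b :: real
  assumes "b \<notin> \<int>"
  shows "countable {t. (1 - t) * a + t * b \<in> \<int>}"
proof (cases "a = b")
  case True
  then have "(1 - t) * a + t * b = b" for t
    by (simp add: algebra_simps)
  then show ?thesis using assms by simp
next
  case False
  have "{t. (1 - t) * a + t * b \<in> \<int>} \<subseteq> (\<lambda>l. (l - a) / (b - a)) ` \<int>"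
  proof
    fix t assume "t \<in> {t. (1 - t) * a + t * b \<in> \<int>}"
    moreover have "t = ((1 - t) * a + t * b - a) / (b - a)"
      using False by (simp add: field_simps)
    ultimately show "t \<in> (\<lambda>l. (l - a) / (b - a)) ` \<int>" by blast
  qed
  then show ?thesis
    by (rule countable_subset) (intro countable_image countable_int)
qed

subsection \<open>Walks in digraphs\<close>

context pre_digraph
begin

lemma cas_drop:
  assumes "cas u c v" "s < length c"
  shows "cas (tail G (c ! s)) (drop s c) v"
proof -
  have "cas (awlast u (take s c)) (drop s c) v"
    using assms(1) cas_append_iff[of u "take s c" "drop s c" v] by simp
  then show ?thesis
    using Cons_nth_drop_Suc[OF assms(2)] by (metis cas.simps(2))
qed

lemma cas_between:
  assumes "cas u c v" "s \<le> t" "t < length c"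
  shows "cas (tail G (c ! s)) (take (t - s) (drop s c)) (tail G (c ! t))"
proof -
  let ?p = "take (t - s) (drop s c)"
  have "drop s c = ?p @ drop t c"
    using assms(2) by (metis append_take_drop_id drop_drop le_add_diff_inverse2)
  moreover have "cas (tail G (c ! s)) (drop s c) v"
    using assms by (intro cas_drop) auto
  ultimately have "cas (tail G (c ! s)) ?p (awlast (tail G (c ! s)) ?p)"
    "cas (awlast (tail G (c ! s)) ?p) (drop t c) v"
    using cas_append_iff by metis+
  moreover have "drop t c \<noteq> []" "hd (drop t c) = c ! t"
    using assms(3) by (simp_all add: hd_drop_conv_nth)
  ultimately show ?thesis
    using cas_simp by metis
qed

lemma cycle_iff_distinct_tails:
  "cycle c \<longleftrightarrow> c \<noteq> [] \<and> (\<exists>u. awalk u c u) \<and> distinct (map (tail G) c)"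
proof -
  have "distinct (tl (awalk_verts u c)) \<longleftrightarrow> distinct (map (tail G) c)"
    if u: "awalk u c u" and "c \<noteq> []" for u
  proof -
    have cas: "cas u c u"
      using u by (simp add: awalk_def)
    then have "cas u (butlast c @ [last c]) u"
      using \<open>c \<noteq> []\<close> by simp
    then have last: "head G (last c) = u"
      unfolding cas_append_iff by simp
    have "map (tail G) c @ [u] = u # map (head G) c"
      using awalk_verts_conv[of u c] awalk_verts_conv'[OF cas] last cas \<open>c \<noteq> []\<close>
      by (simp add: cas_simp)
    then have "mset (map (tail G) c) = mset (map (head G) c)"
      by (metis add_mset_add_single add_mset_remove_trivial mset.simps mset_append)
    then have "distinct (map (tail G) c) \<longleftrightarrow> distinct (map (head G) c)"
      by (rule mset_eq_imp_distinct_iff)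
    then show ?thesis
      using awalk_verts_conv'[OF cas] \<open>c \<noteq> []\<close> by simp
  qed
  then show ?thesis
    by (auto simp: cycle_def)
qed

lemma cas_map_upt:
  assumes "i \<le> j" "\<And>s. tail G (a s) = f s" "\<And>s. head G (a s) = f (Suc s)"
  shows "cas (f i) (map a [i..<j]) (f j)"
  using assms(1) by (induction rule: inc_induct) (simp_all add: upt_conv_Cons assms(2,3))

end

subsection \<open>Barycentric coordinates\<close>

lemma affine_functional_sum:
  fixes f :: "'a::real_vector \<Rightarrow> real"
  assumes "linear (\<lambda>x. f x - f 0)"
  shows "f (\<Sum>i\<in>A. c i *\<^sub>R p i) = (\<Sum>i\<in>A. c i * f (p i)) + (1 - (\<Sum>i\<in>A. c i)) * f 0"
proof -
  have "f (\<Sum>i\<in>A. c i *\<^sub>R p i) - f 0 = (\<Sum>i\<in>A. c i * (f (p i) - f 0))"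
    using linear_sum[OF assms, of "\<lambda>i. c i *\<^sub>R p i" A] linear_scale[OF assms] by simp
  then show ?thesis
    by (simp add: sum_subtractf algebra_simps sum_distrib_left)
qed

lemma affine_functional_convex_comb:
  fixes f :: "'a::real_vector \<Rightarrow> real"
  assumes "linear (\<lambda>x. f x - f 0)" "a + b = 1"
  shows "f (a *\<^sub>R x + b *\<^sub>R y) = a * f x + b * f y"
  using affine_functional_sum[OF assms(1), where A = UNIV and c = "\<lambda>i. if i then a else b"
      and p = "\<lambda>i. if i then x else y"] assms(2)
  by (simp add: UNIV_bool add.commute)

definition open_simplex :: "'a set \<Rightarrow> 'i set \<Rightarrow> ('i \<Rightarrow> 'a \<Rightarrow> real) \<Rightarrow> 'a set" where
  "open_simplex X S b = {x \<in> X. \<forall>s\<in>S. 0 < b s x}"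

definition closed_simplex :: "'a set \<Rightarrow> 'i set \<Rightarrow> ('i \<Rightarrow> 'a \<Rightarrow> real) \<Rightarrow> 'a set" where
  "closed_simplex X S b = {x \<in> X. \<forall>s\<in>S. 0 \<le> b s x}"

lemma open_simplex_subset_closed_simplex: "open_simplex X S b \<subseteq> closed_simplex X S b"
  by (auto simp: open_simplex_def closed_simplex_def less_imp_le)

locale barycentric_coordinates =
  fixes X :: "'a::real_vector set"
    and S :: "'i set"
    and v :: "'i \<Rightarrow> 'a"
    and b :: "'i \<Rightarrow> 'a \<Rightarrow> real"
  assumes finite_index: "finite S"
    and affine_space: "affine X"
    and vertex_in_space: "s \<in> S \<Longrightarrow> v s \<in> X"
    and affine_coord: "s \<in> S \<Longrightarrow> linear (\<lambda>x. b s x - b s 0)"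
    and coord_vertex: "s \<in> S \<Longrightarrow> t \<in> S \<Longrightarrow> b s (v t) = of_bool (s = t)"
    and sum_coords: "x \<in> X \<Longrightarrow> (\<Sum>s\<in>S. b s x) = 1"
    and expansion: "x \<in> X \<Longrightarrow> (\<Sum>s\<in>S. b s x *\<^sub>R v s) = x"
begin

lemma coord_comb_vertices:
  assumes "s \<in> S"
  shows "b s (\<Sum>t\<in>S. c t *\<^sub>R v t) = c s + (1 - (\<Sum>t\<in>S. c t)) * b s 0"
proof -
  have "(\<Sum>t\<in>S. c t * b s (v t)) = (\<Sum>t\<in>S. if s = t then c t else 0)"
    using assms by (intro sum.cong) (auto simp: coord_vertex)
  then show ?thesis
    using assms by (simp add: affine_functional_sum[OF affine_coord] finite_index)
qed

lemma inj_on_vertex: "inj_on v S"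
proof (rule inj_onI)
  fix s t assume "s \<in> S" "t \<in> S" "v s = v t"
  then show "s = t"
    using coord_vertex[of s s] coord_vertex[of s t] by (simp split: if_splits)
qed

lemma affine_independent_vertices: "\<not> affine_dependent (v ` S)"
proof
  assume "affine_dependent (v ` S)"
  then obtain U where U: "sum U (v ` S) = 0" "\<exists>p\<in>v ` S. U p \<noteq> 0" "(\<Sum>p\<in>v ` S. U p *\<^sub>R p) = 0"
    by (auto simp: affine_dependent_explicit_finite finite_index)
  then have "(\<Sum>s\<in>S. U (v s)) = 0" "(\<Sum>s\<in>S. U (v s) *\<^sub>R v s) = 0"
    by (simp_all add: sum.reindex[OF inj_on_vertex])
  then have "U (v s) = 0" if "s \<in> S" for s
    using coord_comb_vertices[OF that, of "\<lambda>s. U (v s)"] by simp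
  then show False using U(2) by blast
qed

lemma convex_hull_vertices_subset: "convex hull (v ` S) \<subseteq> X"
  by (intro hull_minimal affine_imp_convex affine_space) (auto intro: vertex_in_space)

lemma half_open_segment_in_open_simplex:
  assumes x: "x \<in> closed_simplex X S b" and y: "y \<in> open_simplex X S b"
    and pq: "0 \<le> p" "0 < q" "p + q = 1"
  shows "p *\<^sub>R x + q *\<^sub>R y \<in> open_simplex X S b"
proof -
  have "0 < p * b s x + q * b s y" if "s \<in> S" for s
    using x y pq that unfolding open_simplex_def closed_simplex_def
    by (intro add_nonneg_pos mult_nonneg_nonneg mult_pos_pos) auto
  moreover have "p *\<^sub>R x + q *\<^sub>R y \<in> X"
    using affine_space x y pq(3) by (auto simp: affine_def open_simplex_def closed_simplex_def)
  ultimately show ?thesis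
    using pq(3) by (simp add: open_simplex_def affine_functional_convex_comb[OF affine_coord])
qed

lemma convex_open_simplex: "convex (open_simplex X S b)"
proof (rule convexI)
  fix x y and p q :: real
  assume "x \<in> open_simplex X S b" "y \<in> open_simplex X S b" "0 \<le> p" "0 \<le> q" "p + q = 1"
  then show "p *\<^sub>R x + q *\<^sub>R y \<in> open_simplex X S b"
    using half_open_segment_in_open_simplex[of x y p q]
      open_simplex_subset_closed_simplex[of X S b]
    by (cases "q = 0") auto
qed

lemma closed_simplex_eq_hull: "closed_simplex X S b = convex hull (v ` S)"
proof (intro equalityI subsetI)
  fix x assume x: "x \<in> closed_simplex X S b"
  then have "(\<Sum>s\<in>S. b s x *\<^sub>R v s) \<in> convex hull (v ` S)"
    by (intro convex_sum convex_convex_hull finite_index)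
      (auto simp: closed_simplex_def sum_coords hull_inc)
  then show "x \<in> convex hull (v ` S)"
    using x by (simp add: closed_simplex_def expansion)
next
  fix x assume x: "x \<in> convex hull (v ` S)"
  then obtain U where U: "\<forall>p\<in>v ` S. 0 \<le> U p" "sum U (v ` S) = 1" "(\<Sum>p\<in>v ` S. U p *\<^sub>R p) = x"
    by (auto simp: convex_hull_finite finite_index)
  then have "(\<Sum>s\<in>S. U (v s)) = 1" "(\<Sum>s\<in>S. U (v s) *\<^sub>R v s) = x"
    by (simp_all add: sum.reindex[OF inj_on_vertex])
  then have "b s x = U (v s)" if "s \<in> S" for s
    using coord_comb_vertices[OF that, of "\<lambda>s. U (v s)"] by simp
  then show "x \<in> closed_simplex X S b"
    using x U(1) convex_hull_vertices_subset by (auto simp: closed_simplex_def)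
qed

lemma open_simplex_nonempty:
  assumes "S \<noteq> {}"
  shows "open_simplex X S b \<noteq> {}"
proof -
  define c where "c = (\<Sum>s\<in>S. (1 / real (card S)) *\<^sub>R v s)"
  have card: "0 < card S"
    using assms finite_index by (simp add: card_gt_0_iff)
  then have "c \<in> convex hull (v ` S)"
    unfolding c_def by (intro convex_sum convex_convex_hull finite_index) (auto intro: hull_inc)
  moreover have "b s c = 1 / real (card S)" if "s \<in> S" for s
    using coord_comb_vertices[OF that, of "\<lambda>_. 1 / real (card S)"] card by (simp add: c_def)
  ultimately show ?thesis
    using card convex_hull_vertices_subset by (auto simp: open_simplex_def)
qed

lemma integral_point_of_closed_simplex_is_vertex:
  assumes "x \<in> closed_simplex X S b" and Ints: "\<And>s. s \<in> S \<Longrightarrow> b s x \<in> \<int>"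
  shows "x \<in> v ` S"
proof -
  have x: "x \<in> X" "\<And>s. s \<in> S \<Longrightarrow> 0 \<le> b s x"
    using assms(1) by (auto simp: closed_simplex_def)
  define c where "c s = nat \<lfloor>b s x\<rfloor>" for s
  have c: "b s x = real (c s)" if "s \<in> S" for s
    using x(2)[OF that] Ints[OF that] by (simp add: c_def)
  have "real (\<Sum>s\<in>S. c s) = 1"
    using sum_coords[OF x(1)] by (simp add: c)
  then have "(\<Sum>s\<in>S. c s) = 1" by linarith
  then obtain t where t: "t \<in> S" "c t = 1" "\<forall>s\<in>S. t \<noteq> s \<longrightarrow> c s = 0"
    using sum_eq_1_iff[OF finite_index, of c] by blast
  then have "(\<Sum>s\<in>S. b s x *\<^sub>R v s) = (\<Sum>s\<in>S. if s = t then v s else 0)"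
    by (intro sum.cong) (auto simp: c)
  then have "x = v t"
    using t(1) by (simp add: finite_index expansion x(1))
  then show ?thesis using t(1) by blast
qed

end

subsection \<open>Topology of the function space\<close>

lemma continuous_on_segment:
  fixes x y :: "'i \<Rightarrow> 'b::real_normed_vector"
  shows "continuous_on A (\<lambda>t. (1 - t) *\<^sub>R x + t *\<^sub>R y)"
  by (rule continuous_on_coordinatewise_then_product)
    (auto simp: scaleR_fun_def intro!: continuous_intros)

lemma convex_imp_connected_fun:
  fixes A :: "('i \<Rightarrow> 'b::real_normed_vector) set"
  assumes "convex A"
  shows "connected A"
proof -
  have "\<exists>T. connected T \<and> T \<subseteq> A \<and> x \<in> T \<and> y \<in> T" if xy: "x \<in> A" "y \<in> A" for x y
  proof (intro exI conjI)
    let ?f = "\<lambda>t. (1 - t) *\<^sub>R x + t *\<^sub>R y"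
    show "connected (?f ` {0..1})"
      by (intro connected_continuous_image continuous_on_segment) simp
    show "?f ` {0..1} \<subseteq> A"
      using convexD[OF assms xy] by auto
    show "x \<in> ?f ` {0..1}" by (rule image_eqI[of _ _ 0]) auto
    show "y \<in> ?f ` {0..1}" by (rule image_eqI[of _ _ 1]) auto
  qed
  then show ?thesis
    by (intro connected_iff_connected_component[THEN iffD2] ballI)
      (simp add: connected_component_def)
qed

lemma mem_closure_if_countable_segment_diff:
  fixes x y :: "'i \<Rightarrow> 'b::real_normed_vector"
  assumes "countable {t \<in> {0<..<1}. (1 - t) *\<^sub>R x + t *\<^sub>R y \<notin> A}"
  shows "x \<in> closure A"
proof -
  define B where "B = {t \<in> {0<..<1}. (1 - t) *\<^sub>R x + t *\<^sub>R y \<notin> A}"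
  let ?f = "\<lambda>t. (1 - t) *\<^sub>R x + t *\<^sub>R y"
  have "0 \<in> closure ({0<..<1} - B)"
    unfolding closure_approachable
  proof (intro allI impI)
    fix e :: real assume "0 < e"
    then have "uncountable ({0<..<min e 1} - B)"
      using assms unfolding B_def[symmetric]
      by (intro uncountable_minus_countable) (simp_all add: uncountable_open_interval)
    then obtain t where "t \<in> {0<..<min e 1} - B"
      by (metis countable_empty ex_in_conv)
    then show "\<exists>t\<in>{0<..<1} - B. dist t 0 < e"
      by (intro bexI[of _ t]) auto
  qed
  moreover have "?f ` closure ({0<..<1} - B) \<subseteq> closure A"
    by (rule image_closure_subset[OF continuous_on_segment closed_closure])
      (use closure_subset[of A] in \<open>auto simp: B_def\<close>)
  ultimately have "?f 0 \<in> closure A" by blast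
  then show ?thesis by simp
qed

subsection \<open>Counting functions and sorted pairs\<close>

definition card_upto :: "nat set \<Rightarrow> nat \<Rightarrow> nat" where
  "card_upto I i = card {j \<in> I. j \<le> i}"

lemma card_upto_0: "card_upto I 0 = of_bool (0 \<in> I)"
proof -
  have "{j \<in> I. j = 0} = (if 0 \<in> I then {0} else {})"
    by auto
  then show ?thesis
    by (simp add: card_upto_def)
qed

lemma card_upto_Suc: "card_upto I (Suc i) = card_upto I i + of_bool (Suc i \<in> I)"
proof -
  have "{j \<in> I. j \<le> Suc i} = {j \<in> I. j \<le> i} \<union> (if Suc i \<in> I then {Suc i} else {})"
    by (auto simp: le_Suc_eq)
  then show ?thesis
    by (simp add: card_upto_def)
qed

lemma card_upto_inject: "card_upto I = card_upto J \<longleftrightarrow> I = J"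
proof
  assume eq: "card_upto I = card_upto J"
  have "i \<in> I \<longleftrightarrow> i \<in> J" for i
    using fun_cong[OF eq, of i] fun_cong[OF eq, of "i - 1"]
    by (cases i) (auto simp: card_upto_0 card_upto_Suc of_bool_def split: if_splits)
  then show "I = J" by blast
qed simp

context
  fixes I J :: "nat set"
  assumes finite_sets: "finite I" "finite J"
begin

lemma sorted_union_nth_le_iff:
  assumes "t < length (sorted_union I J)"
  shows "sorted_union I J ! t \<le> i \<longleftrightarrow> t < card_upto I i + card_upto J i"
proof -
  have "mset (filter (\<lambda>x. x \<le> i) (sorted_union I J)) =
      mset_set {x \<in> I. x \<le> i} + mset_set {x \<in> J. x \<le> i}"
    using finite_sets by (simp add: sorted_union_def mset_filter)
  then have "length (filter (\<lambda>x. x \<le> i) (sorted_union I J)) = card_upto I i + card_upto J i"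
    by (metis size_mset size_union size_mset_set card_upto_def)
  then show ?thesis
    using sorted_nth_le_iff[OF _ assms, of i] by (simp add: sorted_union_def)
qed

lemma card_upto_le_length_sorted_union:
  "card_upto I i + card_upto J i \<le> length (sorted_union I J)"
proof -
  have "mset (sorted_union I J) = mset_set I + mset_set J"
    by (simp add: sorted_union_def)
  then have "length (sorted_union I J) = card I + card J"
    by (metis size_mset size_union size_mset_set)
  moreover have "card_upto I i \<le> card I" "card_upto J i \<le> card J"
    using finite_sets by (auto simp: card_upto_def intro: card_mono)
  ultimately show ?thesis by simp
qed

lemma sorted_union_nth_less_if_gap:
  assumes "s + 1 < t" "t < length (sorted_union I J)"
  shows "sorted_union I J ! s < sorted_union I J ! t"
proof -
  define i where "i = sorted_union I J ! s"
  have s: "s < card_upto I i + card_upto J i" "j < i \<Longrightarrow> card_upto I j + card_upto J j \<le> s" for j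
    using sorted_union_nth_le_iff[of s] assms by (auto simp: i_def not_less[symmetric])
  have "card_upto I i + card_upto J i \<le> s + 2"
  proof (cases i)
    case (Suc j)
    then show ?thesis using s(2)[of j] by (simp add: card_upto_Suc)
  qed (simp add: card_upto_0)
  then have "\<not> t < card_upto I i + card_upto J i"
    using assms by simp
  then show ?thesis
    using sorted_union_nth_le_iff[OF assms(2), of i] by (simp add: i_def)
qed

text \<open>
  A value occurs at most twice in the sorted union, so entries at positions of the same parity
  are distinct.
\<close>

lemma card_upto_sorted_union_positions:
  assumes P: "\<And>t. P t \<Longrightarrow> \<not> P (Suc t)"
  shows "card_upto {sorted_union I J ! t | t. t < length (sorted_union I J) \<and> P t} i =
    card {t. t < card_upto I i + card_upto J i \<and> P t}" (is "card_upto ?A i = card ?T")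
proof -
  have "{j \<in> ?A. j \<le> i} = (!) (sorted_union I J) ` ?T"
    using card_upto_le_length_sorted_union[of i]
    by (auto simp: sorted_union_nth_le_iff)
  moreover have "inj_on ((!) (sorted_union I J)) ?T"
  proof (rule linorder_inj_onI)
    fix s t assume st: "s < t" "s \<in> ?T" "t \<in> ?T"
    then have "s + 1 \<noteq> t" using P by auto
    then have "sorted_union I J ! s < sorted_union I J ! t"
      using st card_upto_le_length_sorted_union[of i] by (intro sorted_union_nth_less_if_gap) auto
    then show "sorted_union I J ! s \<noteq> sorted_union I J ! t" by simp
  qed auto
  ultimately show ?thesis
    by (simp add: card_upto_def card_image)
qed

lemma card_upto_sort_U: "card_upto (sort_U I J) i = (card_upto I i + card_upto J i + 1) div 2"
  unfolding sort_U_def by (subst card_upto_sorted_union_positions) (auto simp: card_even_less)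

lemma card_upto_sort_V: "card_upto (sort_V I J) i = (card_upto I i + card_upto J i) div 2"
  unfolding sort_V_def by (subst card_upto_sorted_union_positions) (auto simp: card_odd_less)

lemma sorted_pair_iff:
  "sorted_pair I J \<longleftrightarrow> (\<forall>i. card_upto J i \<le> card_upto I i \<and> card_upto I i \<le> card_upto J i + 1)"
proof -
  have "sorted_pair I J \<longleftrightarrow> (\<forall>i. card_upto I i = card_upto (sort_U I J) i \<and>
      card_upto J i = card_upto (sort_V I J) i)"
    unfolding sorted_pair_def card_upto_inject[symmetric] fun_eq_iff by blast
  also have "\<dots> \<longleftrightarrow> (\<forall>i. card_upto J i \<le> card_upto I i \<and> card_upto I i \<le> card_upto J i + 1)"
    unfolding card_upto_sort_U card_upto_sort_V by (intro all_cong1) presburger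
  finally show ?thesis .
qed

end

subsection \<open>Subsets with prescribed counting functions\<close>

definition jumps :: "nat \<Rightarrow> (nat \<Rightarrow> nat) \<Rightarrow> nat set" where
  "jumps n F = {i \<in> {1..n}. F (i - 1) < F i}"

lemma card_upto_jumps:
  assumes "F 0 = 0" "\<And>i. F i \<le> F (Suc i)" "\<And>i. F (Suc i) \<le> F i + 1" "i \<le> n"
  shows "card_upto (jumps n F) i = F i"
  using assms(4)
proof (induction i)
  case 0
  then show ?case by (simp add: card_upto_0 jumps_def assms(1))
next
  case (Suc i)
  then show ?case
    using assms(2,3)[of i] by (auto simp: card_upto_Suc jumps_def)
qed

lemma finite_k_subset: "I \<in> k_subsets k n \<Longrightarrow> finite I"
  by (auto simp: k_subsets_def intro: finite_subset)

lemma finite_k_subsets: "finite (k_subsets k n)"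
  by (simp add: k_subsets_def)

lemma card_upto_k_subset_0: "I \<in> k_subsets k n \<Longrightarrow> card_upto I 0 = 0"
  by (auto simp: card_upto_0 k_subsets_def)

lemma card_upto_k_subset_top:
  assumes "I \<in> k_subsets k n" "n \<le> i"
  shows "card_upto I i = k"
proof -
  have "{j \<in> I. j \<le> i} = I" "card I = k"
    using assms by (auto simp: k_subsets_def)
  then show ?thesis by (simp add: card_upto_def)
qed

lemma all_card_upto_k_subsets_iff:
  assumes "I \<in> k_subsets k (Suc m)" "J \<in> k_subsets k (Suc m)" "Q 0 0" "Q k k"
  shows "(\<forall>i. Q (card_upto I i) (card_upto J i)) \<longleftrightarrow>
    (\<forall>i\<in>{1..m}. Q (card_upto I i) (card_upto J i))"
proof -
  have "Q (card_upto I i) (card_upto J i)" if "i \<notin> {1..m}" for i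
  proof -
    consider "i = 0" | "Suc m \<le> i" using \<open>i \<notin> {1..m}\<close> by fastforce
    then show ?thesis
      using assms by cases (simp_all add: card_upto_k_subset_0 card_upto_k_subset_top)
  qed
  then show ?thesis by blast
qed

lemma k_subset_eqI:
  assumes "I \<in> k_subsets k (Suc m)" "J \<in> k_subsets k (Suc m)"
    and "\<And>i. i \<in> {1..m} \<Longrightarrow> card_upto I i = card_upto J i"
  shows "I = J"
proof -
  have "\<forall>i. card_upto I i = card_upto J i"
    using all_card_upto_k_subsets_iff[OF assms(1,2), of "(=)"] assms(3) by simp
  then show ?thesis
    by (simp add: fun_eq_iff flip: card_upto_inject)
qed

lemma sorted_pair_k_subsets_iff:
  assumes "I \<in> k_subsets k (Suc m)" "J \<in> k_subsets k (Suc m)"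
  shows "sorted_pair I J \<longleftrightarrow>
    (\<forall>i\<in>{1..m}. card_upto J i \<le> card_upto I i \<and> card_upto I i \<le> card_upto J i + 1)"
  using sorted_pair_iff[of I J] assms
    all_card_upto_k_subsets_iff[OF assms, of "\<lambda>a b. b \<le> a \<and> a \<le> b + 1"]
  by (simp add: finite_k_subset)

subsection \<open>Partial sums\<close>

lemma z_coord_0 [simp]: "z_coord x 0 = 0"
  by (simp add: z_coord_def)

lemma z_coord_Suc: "z_coord x (Suc i) = z_coord x i + x (Suc i)"
  by (simp add: z_coord_def)

lemma linear_z_coord: "linear (\<lambda>x. z_coord x i)"
  by (rule linearI) (simp_all add: z_coord_def sum.distrib scaleR_fun_def sum_distrib_left)

lemmas z_coord_add = linear_add[OF linear_z_coord]
lemmas z_coord_scaleR = linear_scale[OF linear_z_coord, unfolded real_scaleR_def]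
lemmas z_coord_sum = linear_sum[OF linear_z_coord]

lemma continuous_on_z_coord: "continuous_on A (\<lambda>x. z_coord x i)"
  unfolding z_coord_def
  by (intro continuous_on_sum continuous_on_subset[OF continuous_on_product_coordinates]) auto

lemma coord_space_eqI:
  assumes "x \<in> coord_space m" "y \<in> coord_space m"
    and "\<And>i. i \<le> m \<Longrightarrow> z_coord x i = z_coord y i"
  shows "x = y"
proof
  fix i
  show "x i = y i"
  proof (cases "i \<in> {1..m}")
    case True
    then obtain j where "i = Suc j" "j < m" by (cases i) auto
    then show ?thesis
      using assms(3)[of j] assms(3)[of i] by (simp add: z_coord_Suc)
  next
    case False
    then show ?thesis using assms(1,2) by (auto simp: coord_space_def)
  qed
qed

lemma subspace_coord_space: "subspace (coord_space m)"
  by (auto simp: subspace_def coord_space_def scaleR_fun_def)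

lemma closed_coord_space: "closed (coord_space m)"
proof -
  have "coord_space m = (\<Inter>i\<in>- {1..m}. {x. x i = 0})"
    by (auto simp: coord_space_def)
  then show ?thesis
    by (simp add: closed_Collect_eq closed_INT)
qed

lemma z_coord_eps:
  assumes "0 \<notin> I"
  shows "z_coord (eps I) i = real (card_upto I i)"
  by (induction i)
    (simp_all add: assms card_upto_0 card_upto_Suc z_coord_Suc eps_def indicator_def)

lemma z_coord_eps_k_subset:
  assumes "I \<in> k_subsets k n"
  shows "z_coord (eps I) i = real (card_upto I i)"
  by (rule z_coord_eps) (use assms in \<open>auto simp: k_subsets_def\<close>)

lemma linear_drop_last_coord: "linear (drop_last_coord n)"
  by (rule linearI) (auto simp: drop_last_coord_def scaleR_fun_def)

lemma drop_last_coord_in_coord_space: "drop_last_coord (Suc m) x \<in> coord_space m"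
  by (auto simp: drop_last_coord_def coord_space_def)

lemma z_coord_drop_last_coord: "i \<le> m \<Longrightarrow> z_coord (drop_last_coord (Suc m) x) i = z_coord x i"
  unfolding z_coord_def by (intro sum.cong) (auto simp: drop_last_coord_def)

definition proj_vertex :: "nat \<Rightarrow> nat set \<Rightarrow> nat \<Rightarrow> real" where
  "proj_vertex m I = drop_last_coord (Suc m) (eps I)"

lemma proj_vertex_in_coord_space: "proj_vertex m I \<in> coord_space m"
  by (simp add: proj_vertex_def drop_last_coord_in_coord_space)

lemma z_coord_proj_vertex:
  assumes "I \<in> k_subsets k (Suc m)" "i \<le> m"
  shows "z_coord (proj_vertex m I) i = real (card_upto I i)"
  using assms by (simp add: proj_vertex_def z_coord_drop_last_coord z_coord_eps_k_subset)

lemma proj_vertex_eq_iff: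
  assumes "I \<in> k_subsets k (Suc m)" "J \<in> k_subsets k (Suc m)"
  shows "proj_vertex m I = proj_vertex m J \<longleftrightarrow> I = J"
proof
  assume eq: "proj_vertex m I = proj_vertex m J"
  show "I = J"
  proof (rule k_subset_eqI[OF assms])
    fix i assume "i \<in> {1..m}"
    then show "card_upto I i = card_upto J i"
      using z_coord_proj_vertex[OF assms(1), of i] z_coord_proj_vertex[OF assms(2), of i] eq
      by simp
  qed
qed simp

lemma convex_hull_proj_vertex:
  "drop_last_coord (Suc m) ` (convex hull (eps ` \<I>)) = convex hull (proj_vertex m ` \<I>)"
  by (simp add: convex_hull_linear_image[OF linear_drop_last_coord] image_image proj_vertex_def)

lemma proj_hypersimplex_iff:
  "x \<in> proj_hypersimplex k (Suc m) \<longleftrightarrow> x \<in> coord_space m \<and>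
    (\<forall>i\<in>{1..m}. x i \<in> {0..1}) \<and> z_coord x m \<in> {real k - 1..real k}"
  by (auto simp: proj_hypersimplex_def unit_cube_def z_coord_def)

lemma convex_proj_hypersimplex: "convex (proj_hypersimplex k (Suc m))"
proof -
  have "proj_hypersimplex k (Suc m) = coord_space m \<inter>
      (\<Inter>i\<in>{1..m}. (\<lambda>x. x i) -` {0..1}) \<inter> (\<lambda>x. z_coord x m) -` {real k - 1..real k}"
    by (auto simp: proj_hypersimplex_iff)
  moreover have "linear (\<lambda>x :: nat \<Rightarrow> real. x i)" for i
    by (rule linearI) (simp_all add: scaleR_fun_def)
  ultimately show ?thesis
    by (simp add: convex_Int convex_INT convex_linear_vimage linear_z_coord
        subspace_imp_convex[OF subspace_coord_space])
qed

lemma proj_vertex_in_proj_hypersimplex: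
  assumes "I \<in> k_subsets k (Suc m)"
  shows "proj_vertex m I \<in> proj_hypersimplex k (Suc m)"
proof -
  have "card_upto I (Suc m) = k"
    using assms by (simp add: card_upto_k_subset_top)
  then have "z_coord (proj_vertex m I) m \<in> {real k - 1..real k}"
    by (auto simp: z_coord_proj_vertex[OF assms] card_upto_Suc)
  then show ?thesis
    by (auto simp: proj_hypersimplex_iff proj_vertex_in_coord_space)
      (auto simp: proj_vertex_def drop_last_coord_def eps_def indicator_def)
qed

subsection \<open>Cells indexed by permutations\<close>

text \<open>
  On the cell of \<open>w\<close> the integer part of \<open>z\<^sub>i\<close> is \<open>cell_floor w i\<close>, the heights are the
  fractional parts in increasing order, completed by 1, and \<open>vertex_sum w s i\<close> is \<open>z\<^sub>i\<close> at the
  vertex where the coordinate \<open>s\<close> is 1. As \<open>w (m + 1) = m + 1\<close>, the value of \<open>vertex_sum\<close> is also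
  right at \<open>i = m + 1\<close>, where it is \<open>k\<close>.
\<close>

definition cell_floor :: "(nat \<Rightarrow> nat) \<Rightarrow> nat \<Rightarrow> nat" where
  "cell_floor w i = card (descents i (inv w))"

definition vertex_sum :: "(nat \<Rightarrow> nat) \<Rightarrow> nat \<Rightarrow> nat \<Rightarrow> nat" where
  "vertex_sum w s i = cell_floor w i + of_bool (s < inv w i)"

definition cell_subset :: "nat \<Rightarrow> (nat \<Rightarrow> nat) \<Rightarrow> nat \<Rightarrow> nat set" where
  "cell_subset m w s = jumps (Suc m) (vertex_sum w s)"

definition cell_subsets :: "nat \<Rightarrow> (nat \<Rightarrow> nat) \<Rightarrow> nat set set" where
  "cell_subsets m w = cell_subset m w ` {..m}"

definition cell_height :: "nat \<Rightarrow> (nat \<Rightarrow> nat) \<Rightarrow> (nat \<Rightarrow> real) \<Rightarrow> nat \<Rightarrow> real" where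
  "cell_height m w x s = (if s \<le> m then z_coord x (w s) - real (cell_floor w (w s)) else 1)"

definition cell_coord :: "nat \<Rightarrow> (nat \<Rightarrow> nat) \<Rightarrow> nat \<Rightarrow> (nat \<Rightarrow> real) \<Rightarrow> real" where
  "cell_coord m w s x = cell_height m w x (Suc s) - cell_height m w x s"

definition open_cell :: "nat \<Rightarrow> (nat \<Rightarrow> nat) \<Rightarrow> (nat \<Rightarrow> real) set" where
  "open_cell m w = open_simplex (coord_space m) {..m} (cell_coord m w)"

definition closed_cell :: "nat \<Rightarrow> (nat \<Rightarrow> nat) \<Rightarrow> (nat \<Rightarrow> real) set" where
  "closed_cell m w = closed_simplex (coord_space m) {..m} (cell_coord m w)"

lemma open_cell_subset_closed_cell: "open_cell m w \<subseteq> closed_cell m w"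
  unfolding open_cell_def closed_cell_def by (rule open_simplex_subset_closed_simplex)

lemma affine_cell_coord: "linear (\<lambda>x. cell_coord m w s x - cell_coord m w s 0)"
proof -
  have "linear (\<lambda>x. cell_height m w x r - cell_height m w 0 r)" for r
    using linear_z_coord[of "w r"] linear_0[OF linear_z_coord[of "w r"]]
    by (cases "r \<le> m") (simp_all add: cell_height_def linear_zero)
  from linear_compose_sub[OF this[of "Suc s"] this[of s]] show ?thesis
    by (simp add: cell_coord_def algebra_simps)
qed

lemma continuous_on_cell_coord: "continuous_on A (cell_coord m w s)"
proof -
  have "continuous_on A (\<lambda>x. cell_height m w x r)" for r
    by (cases "r \<le> m") (auto simp: cell_height_def intro!: continuous_intros continuous_on_z_coord)
  then show ?thesis
    unfolding cell_coord_def[abs_def] by (intro continuous_on_diff)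
qed

lemma closed_closed_cell: "closed (closed_cell m w)"
proof -
  have "closed_cell m w = coord_space m \<inter> (\<Inter>s\<in>{..m}. {x. 0 \<le> cell_coord m w s x})"
    by (auto simp: closed_cell_def closed_simplex_def)
  then show ?thesis
    by (simp add: closed_Int closed_coord_space closed_INT closed_Collect_le
        continuous_on_cell_coord)
qed

context
  fixes m :: nat and w :: "nat \<Rightarrow> nat"
  assumes w: "w permutes {1..m}"
begin

lemma permutes_interval_0: "w 0 = 0" "inv w 0 = 0"
  and permutes_interval_Suc: "w (Suc m) = Suc m" "inv w (Suc m) = Suc m"
  using permutes_not_in[OF w] permutes_not_in[OF permutes_inv[OF w]] by simp_all

lemma permutes_interval_le_iff: "w i \<le> m \<longleftrightarrow> i \<le> m" "inv w i \<le> m \<longleftrightarrow> i \<le> m"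
proof -
  have "w permutes {..m}"
    by (rule permutes_subset[OF w]) auto
  then show "w i \<le> m \<longleftrightarrow> i \<le> m" "inv w i \<le> m \<longleftrightarrow> i \<le> m"
    using permutes_in_image[of w "{..m}"] permutes_in_image[OF permutes_inv, of w "{..m}"]
    by simp_all
qed

lemma cell_floor_0: "cell_floor w 0 = 0"
  by (simp add: cell_floor_def descents_def)

lemma cell_floor_Suc: "cell_floor w (Suc i) = cell_floor w i + of_bool (inv w (Suc i) < inv w i)"
proof -
  have "descents (Suc i) (inv w) =
      descents i (inv w) \<union> (if inv w (Suc i) < inv w i then {i} else {})"
    by (auto simp: descents_def less_Suc_eq Suc_le_eq permutes_interval_0 intro!: gr0I)
  moreover have "finite (descents i (inv w))" "i \<notin> descents i (inv w)"
    by (simp_all add: descents_def)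
  ultimately show ?thesis
    by (simp add: cell_floor_def)
qed

lemma vertex_sum_0: "vertex_sum w s 0 = 0"
  by (simp add: vertex_sum_def cell_floor_0 permutes_interval_0)

lemma vertex_sum_top:
  assumes "s \<le> m"
  shows "vertex_sum w s (Suc m) = Suc (cell_floor w m)"
  using assms permutes_interval_le_iff(2)[of m]
  by (simp add: vertex_sum_def cell_floor_Suc permutes_interval_Suc)

lemma card_upto_cell_subset: "i \<le> Suc m \<Longrightarrow> card_upto (cell_subset m w s) i = vertex_sum w s i"
  unfolding cell_subset_def
  by (rule card_upto_jumps) (auto simp: vertex_sum_0, auto simp: vertex_sum_def cell_floor_Suc)

lemma cell_subset_in_k_subsets:
  assumes "s \<le> m"
  shows "cell_subset m w s \<in> k_subsets (Suc (cell_floor w m)) (Suc m)"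
proof -
  have "{j \<in> cell_subset m w s. j \<le> Suc m} = cell_subset m w s"
    by (auto simp: cell_subset_def jumps_def)
  then have "card (cell_subset m w s) = card_upto (cell_subset m w s) (Suc m)"
    by (simp add: card_upto_def)
  then show ?thesis
    using assms by (auto simp: k_subsets_def card_upto_cell_subset vertex_sum_top)
      (auto simp: cell_subset_def jumps_def)
qed

lemma z_coord_proj_cell_subset:
  assumes "s \<le> m" "i \<le> m"
  shows "z_coord (proj_vertex m (cell_subset m w s)) i = real (vertex_sum w s i)"
  using assms by (simp add: z_coord_proj_vertex[OF cell_subset_in_k_subsets] card_upto_cell_subset)

lemma cell_height_0: "cell_height m w x 0 = 0"
  by (simp add: cell_height_def cell_floor_0 permutes_interval_0)

lemma z_coord_eq_cell_height:
  "i \<le> m \<Longrightarrow> z_coord x i = real (cell_floor w i) + cell_height m w x (inv w i)"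
  by (simp add: cell_height_def permutes_interval_le_iff permutes_inverses[OF w])

lemma sum_cell_coord: "(\<Sum>s<r. cell_coord m w s x) = cell_height m w x r"
  by (simp add: cell_coord_def sum_lessThan_telescope cell_height_0)

lemma cell_height_vertex:
  assumes "t \<le> m" "s \<le> Suc m"
  shows "cell_height m w (proj_vertex m (cell_subset m w t)) s = of_bool (t < s)"
  using assms
  by (auto simp: cell_height_def z_coord_proj_cell_subset vertex_sum_def permutes_interval_le_iff
      permutes_inverses[OF w])

lemma sum_cell_coord_vertices:
  assumes x: "x \<in> coord_space m"
  shows "(\<Sum>s\<le>m. cell_coord m w s x *\<^sub>R proj_vertex m (cell_subset m w s)) = x" (is "?y = x")
proof (rule coord_space_eqI)
  show "?y \<in> coord_space m" "x \<in> coord_space m"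
    using x by (simp_all add: subspace_sum subspace_scale subspace_coord_space
        proj_vertex_in_coord_space)
  fix i assume i: "i \<le> m"
  have "z_coord ?y i = (\<Sum>s\<le>m. cell_coord m w s x * real (vertex_sum w s i))"
    using i by (simp add: z_coord_sum z_coord_scaleR z_coord_proj_cell_subset)
  also have "\<dots> = (\<Sum>s\<le>m. cell_coord m w s x * real (cell_floor w i)) +
      (\<Sum>s\<le>m. if s < inv w i then cell_coord m w s x else 0)"
    unfolding sum.distrib[symmetric]
    by (intro sum.cong) (auto simp: vertex_sum_def distrib_left)
  also have "(\<Sum>s\<le>m. cell_coord m w s x * real (cell_floor w i)) = real (cell_floor w i)"
    using sum_cell_coord[of x "Suc m"]
    by (simp add: lessThan_Suc_atMost cell_height_def flip: sum_distrib_right)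
  also have "(\<Sum>s\<le>m. if s < inv w i then cell_coord m w s x else 0) =
      (\<Sum>s<inv w i. cell_coord m w s x)"
    using permutes_interval_le_iff(2)[of i] i
    by (intro sum.mono_neutral_cong_right) auto
  finally show "z_coord ?y i = z_coord x i"
    by (simp add: sum_cell_coord z_coord_eq_cell_height[OF i])
qed

interpretation cell: barycentric_coordinates "coord_space m" "{..m}"
    "\<lambda>s. proj_vertex m (cell_subset m w s)" "cell_coord m w"
proof (rule barycentric_coordinates.intro)
  show "(\<Sum>s\<le>m. cell_coord m w s x) = 1" if "x \<in> coord_space m" for x
    using sum_cell_coord[of x "Suc m"] by (simp add: lessThan_Suc_atMost cell_height_def)
  show "linear (\<lambda>x. cell_coord m w s x - cell_coord m w s 0)" for s
    by (rule affine_cell_coord)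
  show "cell_coord m w s (proj_vertex m (cell_subset m w t)) = of_bool (s = t)"
    if "s \<in> {..m}" "t \<in> {..m}" for s t
    using that by (auto simp: cell_coord_def cell_height_vertex)
qed (simp_all only: finite_atMost subspace_imp_affine subspace_coord_space
    proj_vertex_in_coord_space sum_cell_coord_vertices)

lemma closed_cell_eq_hull: "closed_cell m w = convex hull (proj_vertex m ` cell_subsets m w)"
  unfolding closed_cell_def cell.closed_simplex_eq_hull cell_subsets_def image_image ..

lemma is_simplex_closed_cell: "is_simplex m (closed_cell m w)"
  unfolding is_simplex_def closed_cell_def cell.closed_simplex_eq_hull
  using cell.affine_independent_vertices card_image[OF cell.inj_on_vertex]
  by (intro exI conjI refl) simp_all

lemma inj_on_cell_subset: "inj_on (cell_subset m w) {..m}"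
  using cell.inj_on_vertex by (auto simp: inj_on_def)

lemma cell_subsets_subset_k_subsets: "cell_subsets m w \<subseteq> k_subsets (Suc (cell_floor w m)) (Suc m)"
  by (auto simp: cell_subsets_def cell_subset_in_k_subsets)

lemma finite_cell_subsets: "finite (cell_subsets m w)"
  and card_cell_subsets: "card (cell_subsets m w) = Suc m"
  by (simp_all add: cell_subsets_def card_image[OF inj_on_cell_subset])

lemma closed_cell_subset_proj_hypersimplex:
  "closed_cell m w \<subseteq> proj_hypersimplex (Suc (cell_floor w m)) (Suc m)"
  unfolding closed_cell_eq_hull
  by (intro hull_minimal convex_proj_hypersimplex)
    (use cell_subsets_subset_k_subsets in \<open>auto intro: proj_vertex_in_proj_hypersimplex\<close>)

lemma cell_coord_proj_vertex_in_Ints: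
  assumes "I \<in> k_subsets k (Suc m)"
  shows "cell_coord m w s (proj_vertex m I) \<in> \<int>"
proof -
  have "cell_height m w (proj_vertex m I) r \<in> \<int>" for r
    by (simp add: cell_height_def z_coord_proj_vertex[OF assms] permutes_interval_le_iff)
  then show ?thesis
    by (simp add: cell_coord_def)
qed

lemma proj_vertex_in_closed_cellD:
  assumes I: "I \<in> k_subsets (Suc (cell_floor w m)) (Suc m)" and "proj_vertex m I \<in> closed_cell m w"
  shows "I \<in> cell_subsets m w"
proof -
  have "proj_vertex m I \<in> (\<lambda>s. proj_vertex m (cell_subset m w s)) ` {..m}"
    using assms(2) unfolding closed_cell_def
    by (intro cell.integral_point_of_closed_simplex_is_vertex cell_coord_proj_vertex_in_Ints[OF I])
  then show ?thesis
    by (auto simp: cell_subsets_def proj_vertex_eq_iff[OF I cell_subset_in_k_subsets])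
qed

lemma open_cell_nonempty: "open_cell m w \<noteq> {}"
  unfolding open_cell_def by (rule cell.open_simplex_nonempty) simp

lemma connected_open_cell: "connected (open_cell m w)"
  unfolding open_cell_def by (rule convex_imp_connected_fun[OF cell.convex_open_simplex])

lemma closure_open_cell: "closure (open_cell m w) = closed_cell m w"
proof
  show "closure (open_cell m w) \<subseteq> closed_cell m w"
    by (intro closure_minimal open_cell_subset_closed_cell closed_closed_cell)
  obtain y where y: "y \<in> open_cell m w"
    using open_cell_nonempty by blast
  show "closed_cell m w \<subseteq> closure (open_cell m w)"
  proof
    fix x assume x: "x \<in> closed_cell m w"
    have "{t \<in> {0<..<1}. (1 - t) *\<^sub>R x + t *\<^sub>R y \<notin> open_cell m w} = {}"
      using x y cell.half_open_segment_in_open_simplex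
      by (auto simp: open_cell_def closed_cell_def)
    then show "x \<in> closure (open_cell m w)"
      by (intro mem_closure_if_countable_segment_diff[of x y]) (simp only: countable_empty)
  qed
qed

end

subsection \<open>Stanley's regions\<close>

lemma open_cell_iff_strict_mono_cell_height:
  "x \<in> open_cell m w \<longleftrightarrow> x \<in> coord_space m \<and> strict_mono_on {..Suc m} (cell_height m w x)"
  by (auto simp: open_cell_def open_simplex_def cell_coord_def strict_mono_on_atMost_iff_Suc)

context
  fixes m :: nat and w :: "nat \<Rightarrow> nat"
  assumes w: "w permutes {1..m}"
begin

lemma floor_z_coord_eq_cell_floor:
  assumes x: "x \<in> unit_cube m" and mono: "strict_mono_on {..m} (\<lambda>s. frac (z_coord x (w s)))"
    and "i \<le> m"
  shows "\<lfloor>z_coord x i\<rfloor> = int (cell_floor w i)"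
  using assms(3)
proof (induction i)
  case 0
  then show ?case by (simp add: cell_floor_0[OF w])
next
  case (Suc i)
  have less_iff: "frac (z_coord x j) < frac (z_coord x l) \<longleftrightarrow> inv w j < inv w l"
    if "j \<le> m" "l \<le> m" for j l
    using strict_mono_on_less[OF mono, of "inv w j" "inv w l"] that
    by (simp add: permutes_interval_le_iff[OF w] permutes_inverses[OF w])
  have "inv w (Suc i) \<noteq> inv w i"
    using permutes_inj[OF permutes_inv[OF w]] by (simp add: inj_eq)
  then have "frac (z_coord x (Suc i)) \<noteq> frac (z_coord x i)"
    using less_iff[of i "Suc i"] less_iff[of "Suc i" i] Suc.prems by fastforce
  moreover have "0 \<le> x (Suc i)" "x (Suc i) \<le> 1"
    using x Suc.prems by (auto simp: unit_cube_def)
  ultimately show ?case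
    using Suc floor_add_if_frac_neq[of "x (Suc i)" "z_coord x i"] less_iff[of "Suc i" i]
    by (simp add: z_coord_Suc cell_floor_Suc[OF w])
qed

lemma open_cell_iff:
  "x \<in> open_cell m w \<longleftrightarrow>
    x \<in> unit_cube m \<and> strict_mono_on {..m} (\<lambda>s. frac (z_coord x (w s)))"
proof
  assume x: "x \<in> open_cell m w"
  then have mono: "strict_mono_on {..Suc m} (cell_height m w x)"
    by (simp add: open_cell_iff_strict_mono_cell_height)
  have "frac (z_coord x (w s)) = cell_height m w x s" if "s \<le> m" for s
  proof -
    have "0 \<le> cell_height m w x s"
      using strict_mono_on_leD[OF mono, of 0 s] that by (simp add: cell_height_0[OF w])
    moreover have "cell_height m w x s < 1"
      using strict_mono_onD[OF mono, of s "Suc m"] that by (simp add: cell_height_def)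
    ultimately show ?thesis
      using that by (simp add: frac_unique_iff) (simp add: cell_height_def)
  qed
  then have "strict_mono_on {..m} (\<lambda>s. frac (z_coord x (w s)))"
    using mono by (auto simp: strict_mono_on_def)
  moreover have "x \<in> unit_cube m"
    using x open_cell_subset_closed_cell closed_cell_subset_proj_hypersimplex[OF w]
    by (fastforce simp: proj_hypersimplex_def)
  ultimately show "x \<in> unit_cube m \<and> strict_mono_on {..m} (\<lambda>s. frac (z_coord x (w s)))"
    by blast
next
  assume x: "x \<in> unit_cube m \<and> strict_mono_on {..m} (\<lambda>s. frac (z_coord x (w s)))"
  have "cell_height m w x s = frac (z_coord x (w s))" if "s \<le> m" for s
    using that floor_z_coord_eq_cell_floor[of x "w s"] x
    by (simp add: cell_height_def frac_def permutes_interval_le_iff[OF w])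
  then have "strict_mono_on {..Suc m} (cell_height m w x)"
    using x frac_lt_1[of "z_coord x (w m)"]
    by (auto simp: strict_mono_on_atMost_iff_Suc less_Suc_eq cell_height_def[of m w x "Suc m"])
  then show "x \<in> open_cell m w"
    using x by (simp add: open_cell_iff_strict_mono_cell_height unit_cube_def)
qed

lemma stanley_map_in_perm_region_iff:
  assumes "1 \<le> m"
  shows "stanley_map m x \<in> perm_region m w \<longleftrightarrow> strict_mono_on {..m} (\<lambda>s. frac (z_coord x (w s)))"
proof -
  define f where "f s = frac (z_coord x (w s))" for s
  have "stanley_map m x \<in> unit_cube m"
    by (auto simp: unit_cube_def coord_space_def stanley_map_def frac_lt_1 less_imp_le)
  moreover have "stanley_map m x (w s) = f s" if "s \<in> {1..m}" for s
    using permutes_in_image[OF w, of s] that by (simp add: stanley_map_def f_def z_coord_def)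
  ultimately have "stanley_map m x \<in> perm_region m w \<longleftrightarrow>
      0 < f 1 \<and> (\<forall>s\<in>{1..<m}. f s < f (Suc s)) \<and> f m < 1"
    using assms by (simp add: perm_region_def)
  also have "\<dots> \<longleftrightarrow> (\<forall>s\<in>insert 0 {1..<m}. f s < f (Suc s))"
    by (simp add: f_def frac_lt_1 permutes_interval_0[OF w])
  also have "insert 0 {1..<m} = {..<m}"
    using assms by auto
  finally show ?thesis
    by (simp add: strict_mono_on_atMost_iff_Suc f_def lessThan_def)
qed

lemma stanley_region_eq_open_cell:
  assumes "1 \<le> m"
  shows "{x \<in> unit_cube m. stanley_map m x \<in> perm_region m w} = open_cell m w"
  using open_cell_iff stanley_map_in_perm_region_iff[OF assms] by blast

end

definition cell_perms :: "nat \<Rightarrow> nat \<Rightarrow> (nat \<Rightarrow> nat) set" where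
  "cell_perms k m = {w. w permutes {1..m} \<and> card (descents m (inv w)) = k - 1}"

lemma cell_perms_iff:
  assumes "0 < k"
  shows "w \<in> cell_perms k m \<longleftrightarrow> w permutes {1..m} \<and> Suc (cell_floor w m) = k"
  using assms by (auto simp: cell_perms_def cell_floor_def)

lemma stanley_simplices_eq:
  assumes "1 \<le> m"
  shows "stanley_simplices k (Suc m) = closed_cell m ` cell_perms k m"
proof -
  have "closure {x \<in> unit_cube m. stanley_map m x \<in> perm_region m w} = closed_cell m w"
    if "w permutes {1..m}" for w
    using stanley_region_eq_open_cell[OF that assms] closure_open_cell[OF that] by simp
  then show ?thesis
    unfolding stanley_simplices_def cell_perms_def by auto
qed

subsection \<open>Alcoves\<close>

definition generic_points :: "nat \<Rightarrow> (nat \<Rightarrow> real) set" where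
  "generic_points m = {x \<in> coord_space m. inj_on (\<lambda>i. frac (z_coord x i)) {..m}}"

lemma generic_points_eq_complement:
  "generic_points m = coord_space m - \<Union>{alcove_hyperplane m i j l | i j l. i < j \<and> j \<le> m}"
proof -
  have "inj_on (\<lambda>i. frac (z_coord x i)) {..m} \<longleftrightarrow>
      (\<forall>i j. i < j \<and> j \<le> m \<longrightarrow> frac (z_coord x i) \<noteq> frac (z_coord x j))" for x
    by (rule iffI, force dest: inj_onD, rule linorder_inj_onI', simp)
  then have generic: "generic_points m =
      {x \<in> coord_space m. \<forall>i j. i < j \<and> j \<le> m \<longrightarrow> z_coord x i - z_coord x j \<notin> \<int>}"
    by (simp add: generic_points_def frac_eq_frac_iff)
  show ?thesis
    unfolding generic alcove_hyperplane_def Ints_def by blast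
qed

lemma alcoves_eq: "alcoves m = closure ` components (generic_points m)"
  by (simp only: alcoves_def generic_points_eq_complement)

context
  fixes m :: nat and w :: "nat \<Rightarrow> nat"
  assumes w: "w permutes {1..m}"
begin

lemma open_cell_subset_generic_points: "open_cell m w \<subseteq> generic_points m"
proof
  fix x assume "x \<in> open_cell m w"
  then have x: "x \<in> unit_cube m" "inj_on (\<lambda>s. frac (z_coord x (w s))) {..m}"
    by (auto simp: open_cell_iff[OF w] intro: strict_mono_on_imp_inj_on)
  have "inj_on (\<lambda>i. frac (z_coord x i)) {..m}"
  proof (rule inj_onI)
    fix i j assume "i \<in> {..m}" "j \<in> {..m}" "frac (z_coord x i) = frac (z_coord x j)"
    then have "inv w i = inv w j"
      by (intro inj_onD[OF x(2)])
        (simp_all add: permutes_inverses[OF w] permutes_interval_le_iff[OF w])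
    then show "i = j"
      using permutes_inj[OF permutes_inv[OF w]] by (simp add: inj_eq)
  qed
  then show "x \<in> generic_points m"
    using x(1) by (simp add: generic_points_def unit_cube_def)
qed

lemma cell_coord_nonzero_if_generic:
  assumes x: "x \<in> generic_points m" and "1 \<le> m" "s \<le> m"
  shows "cell_coord m w s x \<noteq> 0"
proof
  assume "cell_coord m w s x = 0"
  then have eq: "cell_height m w x (Suc s) = cell_height m w x s"
    by (simp add: cell_coord_def)
  have inj: "i = j" if "i \<le> m" "j \<le> m" "z_coord x i - z_coord x j \<in> \<int>" for i j
    using x that by (auto simp: generic_points_def inj_on_def frac_eq_frac_iff)
  show False
  proof (cases "s < m")
    case True
    then have "z_coord x (w (Suc s)) - z_coord x (w s) =
        of_int (int (cell_floor w (w (Suc s))) - int (cell_floor w (w s)))"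
      using eq by (simp add: cell_height_def)
    then have "w (Suc s) = w s"
      using True by (intro inj) (simp_all add: permutes_interval_le_iff[OF w])
    then show False
      using permutes_inj[OF w] by (simp add: inj_eq)
  next
    case False
    then have "z_coord x (w m) - z_coord x 0 = of_int (1 + int (cell_floor w (w m)))"
      using eq assms(3) by (simp add: cell_height_def)
    then have "w m = w 0"
      using inj[of "w m" 0] by (simp add: permutes_interval_0[OF w] permutes_interval_le_iff[OF w])
    then show False
      using permutes_inj[OF w] assms(2) by (simp add: inj_eq)
  qed
qed

lemma open_cell_in_components:
  assumes "1 \<le> m"
  shows "open_cell m w \<in> components (generic_points m)"
  unfolding in_components_maximal
proof (intro conjI allI impI)
  fix D assume D: "D \<noteq> {} \<and> open_cell m w \<subseteq> D \<and> D \<subseteq> generic_points m \<and> connected D"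
  obtain x where x: "x \<in> open_cell m w"
    using open_cell_nonempty[OF w] by blast
  have "0 < cell_coord m w s y" if "y \<in> D" "s \<le> m" for y s
  proof (rule ccontr)
    assume "\<not> 0 < cell_coord m w s y"
    moreover have "connected (cell_coord m w s ` D)"
      using D by (intro connected_continuous_image continuous_on_cell_coord) auto
    moreover have "0 < cell_coord m w s x"
      using x that by (simp add: open_cell_def open_simplex_def)
    ultimately have "0 \<in> cell_coord m w s ` D"
      using connectedD_interval[of _ "cell_coord m w s y" "cell_coord m w s x" 0] D x that
      by (auto simp: not_less)
    then show False
      using cell_coord_nonzero_if_generic[OF _ assms that(2)] D by force
  qed
  then show "D = open_cell m w"
    using D by (auto simp: open_cell_def open_simplex_def generic_points_def)
qed (use open_cell_nonempty[OF w] open_cell_subset_generic_points connected_open_cell[OF w]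
    in auto)

end

lemma generic_point_in_open_cell:
  assumes x: "x \<in> proj_hypersimplex k (Suc m)" "x \<in> generic_points m" and "1 \<le> m" "0 < k"
  obtains w where "w \<in> cell_perms k m" "x \<in> open_cell m w"
proof -
  have inj: "inj_on (\<lambda>i. frac (z_coord x i)) {..m}"
    using x(2) by (simp add: generic_points_def)
  obtain w where w: "w permutes {1..m}" "strict_mono_on {..m} ((\<lambda>i. frac (z_coord x i)) \<circ> w)"
    by (rule ex_permutes_strict_mono_on[OF inj]) auto
  have cube: "x \<in> unit_cube m"
    using x(1) by (simp add: proj_hypersimplex_def)
  then have "x \<in> open_cell m w"
    using w by (simp add: open_cell_iff o_def)
  moreover have "z_coord x m \<notin> \<int>"
    using inj_onD[OF inj, of m 0] assms(3) by auto
  then have "z_coord x m \<noteq> real k"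
    by auto
  then have "\<lfloor>z_coord x m\<rfloor> = int k - 1"
    using x(1) by (auto simp: floor_eq_iff proj_hypersimplex_iff)
  then have "int (cell_floor w m) = int k - 1"
    using floor_z_coord_eq_cell_floor[OF w(1) cube] w(2) by (simp add: o_def)
  then have "w \<in> cell_perms k m"
    using w(1) assms(4) by (simp add: cell_perms_iff)
  ultimately show ?thesis using that by blast
qed

lemma alcove_simplices_eq:
  assumes "1 \<le> m" "0 < k"
  shows "alcove_simplices k (Suc m) = closed_cell m ` cell_perms k m"
proof (intro equalityI subsetI)
  fix A assume "A \<in> alcove_simplices k (Suc m)"
  then obtain C where C: "C \<in> components (generic_points m)" "A = closure C"
      "A \<subseteq> proj_hypersimplex k (Suc m)"
    by (auto simp: alcove_simplices_def alcoves_eq)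
  obtain x where x: "x \<in> C"
    using C(1) in_components_nonempty by blast
  then have "x \<in> generic_points m" "x \<in> proj_hypersimplex k (Suc m)"
    using C in_components_subset closure_subset by blast+
  then obtain w where w: "w \<in> cell_perms k m" "x \<in> open_cell m w"
    using generic_point_in_open_cell assms by blast
  then have "w permutes {1..m}"
    by (simp add: cell_perms_def)
  then have "A = closed_cell m w"
    using components_eq[OF C(1) open_cell_in_components[OF _ assms(1)]] w(2) x C(2)
    by (auto simp flip: closure_open_cell)
  then show "A \<in> closed_cell m ` cell_perms k m"
    using w(1) by blast
next
  fix A assume "A \<in> closed_cell m ` cell_perms k m"
  then obtain w where w: "w permutes {1..m}" "Suc (cell_floor w m) = k" "A = closed_cell m w"
    using assms(2) by (auto simp: cell_perms_iff)
  then show "A \<in> alcove_simplices k (Suc m)"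
    using open_cell_in_components[OF w(1) assms(1)] closed_cell_subset_proj_hypersimplex[OF w(1)]
    by (auto simp: alcove_simplices_def alcoves_eq simp flip: closure_open_cell)
qed

subsection \<open>The covering of the hypersimplex\<close>

lemma z_coord_eps_interval:
  assumes "i \<le> m"
  shows "z_coord (eps {1..m}) i = real i"
proof -
  have "{j \<in> {1..m}. j \<le> i} = {1..i}"
    using assms by auto
  then show ?thesis
    by (simp add: z_coord_eps card_upto_def)
qed

lemma irrational_scaleR_eps_generic:
  assumes "a \<notin> \<rat>"
  shows "a *\<^sub>R eps {1..m} \<in> generic_points m"
proof -
  have z: "z_coord (a *\<^sub>R eps {1..m}) i = a * real i" if "i \<le> m" for i
    using z_coord_eps_interval[OF that] by (simp only: z_coord_scaleR)
  have "i = j" if "i \<le> m" "j \<le> m" "a * (real i - real j) \<in> \<int>" for i j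
  proof (rule ccontr)
    assume "i \<noteq> j"
    then have "a = a * (real i - real j) / (real i - real j)"
      by simp
    moreover have "a * (real i - real j) \<in> \<rat>"
      using that(3) Ints_subset_Rats by blast
    ultimately have "a \<in> \<rat>"
      by (metis Rats_diff Rats_divide Rats_of_nat)
    then show False
      using assms by simp
  qed
  moreover have "a *\<^sub>R eps {1..m} \<in> coord_space m"
    by (auto simp: coord_space_def eps_def scaleR_fun_def)
  ultimately show ?thesis
    by (auto simp: generic_points_def inj_on_def frac_eq_frac_iff z right_diff_distrib
        simp del: One_nat_def)
qed

lemma generic_points_meet_proj_hypersimplex:
  assumes "0 < k" "k \<le> m"
  obtains q where "q \<in> proj_hypersimplex k (Suc m)" "q \<in> generic_points m"
proof -
  have "uncountable ({(real k - 1) / real m<..<real k / real m} - \<rat>)"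
    using assms by (intro uncountable_minus_countable countable_rat)
      (simp add: uncountable_open_interval divide_strict_right_mono)
  then obtain a where a: "(real k - 1) / real m < a" "a < real k / real m" "a \<notin> \<rat>"
    by (metis Diff_iff countable_empty ex_in_conv greaterThanLessThan_iff)
  have "real k - 1 < a * real m" "a * real m < real k"
    using a assms by (simp_all add: field_simps)
  moreover have "0 \<le> (real k - 1) / real m" "real k / real m \<le> 1"
    using assms by simp_all
  then have "0 < a" "a < 1"
    using a by linarith+
  moreover have "z_coord (a *\<^sub>R eps {1..m}) m = a * real m"
    by (simp only: z_coord_scaleR z_coord_eps_interval[OF order_refl])
  ultimately have "a *\<^sub>R eps {1..m} \<in> proj_hypersimplex k (Suc m)"
    by (auto simp: proj_hypersimplex_iff coord_space_def eps_def scaleR_fun_def)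
  then show ?thesis
    using that irrational_scaleR_eps_generic[OF a(3)] by blast
qed

lemma countable_segment_nongeneric:
  assumes x: "x \<in> coord_space m" and q: "q \<in> generic_points m"
  shows "countable {t. (1 - t) *\<^sub>R x + t *\<^sub>R q \<notin> generic_points m}"
proof -
  define d where "d i j y = z_coord y i - z_coord y j" for i j and y :: "nat \<Rightarrow> real"
  have d_seg: "d i j ((1 - t) *\<^sub>R x + t *\<^sub>R q) = (1 - t) * d i j x + t * d i j q" for i j t
    unfolding d_def z_coord_add z_coord_scaleR by (simp add: algebra_simps)
  have generic_iff: "y \<in> generic_points m \<longleftrightarrow>
      y \<in> coord_space m \<and> (\<forall>i\<le>m. \<forall>j\<in>{..m} - {i}. d i j y \<notin> \<int>)" for y
    by (auto simp: generic_points_def inj_on_def frac_eq_frac_iff d_def)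
  have "(1 - t) *\<^sub>R x + t *\<^sub>R q \<in> coord_space m" for t
    using x q by (intro subspace_add subspace_scale subspace_coord_space)
      (auto simp: generic_points_def)
  then have "{t. (1 - t) *\<^sub>R x + t *\<^sub>R q \<notin> generic_points m} =
      (\<Union>i\<le>m. \<Union>j\<in>{..m} - {i}. {t. (1 - t) * d i j x + t * d i j q \<in> \<int>})"
    by (auto simp: generic_iff d_seg)
  also have "countable \<dots>"
    using q by (intro countable_UN countable_segment_Ints) (auto simp: generic_iff)
  finally show ?thesis .
qed

lemma closed_cells_cover:
  assumes x: "x \<in> proj_hypersimplex k (Suc m)" and k: "0 < k" "k \<le> m"
  obtains w where "w \<in> cell_perms k m" "x \<in> closed_cell m w"
proof -
  define S where "S = (\<Union>w\<in>cell_perms k m. closed_cell m w)"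
  obtain q where q: "q \<in> proj_hypersimplex k (Suc m)" "q \<in> generic_points m"
    using generic_points_meet_proj_hypersimplex[OF k] .
  let ?f = "\<lambda>t. (1 - t) *\<^sub>R x + t *\<^sub>R q"
  have "?f t \<in> S" if t: "t \<in> {0<..<1}" "?f t \<in> generic_points m" for t
  proof -
    have "?f t \<in> proj_hypersimplex k (Suc m)"
      using convexD[OF convex_proj_hypersimplex x q(1), of "1 - t" t] t(1) by auto
    then obtain w where "w \<in> cell_perms k m" "?f t \<in> open_cell m w"
      by (rule generic_point_in_open_cell) (use t(2) k in simp_all)
    then show ?thesis
      using open_cell_subset_closed_cell by (auto simp: S_def)
  qed
  then have "{t \<in> {0<..<1}. ?f t \<notin> S} \<subseteq> {t. ?f t \<notin> generic_points m}"
    by blast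
  moreover have "countable {t. ?f t \<notin> generic_points m}"
    using x q(2) by (intro countable_segment_nongeneric) (simp_all add: proj_hypersimplex_iff)
  ultimately have "x \<in> closure S"
    by (rule countable_subset[THEN mem_closure_if_countable_segment_diff])
  moreover have "finite (cell_perms k m)"
    by (rule finite_subset[OF _ finite_permutations[of "{1..m}"]]) (auto simp: cell_perms_def)
  then have "closed S"
    unfolding S_def by (intro closed_UN) (simp_all add: closed_closed_cell)
  ultimately show ?thesis
    using that by (auto simp: S_def)
qed

lemma cell_perms_nonempty:
  assumes "0 < k" "k \<le> m"
  shows "cell_perms k m \<noteq> {}"
  by (metis assms closed_cells_cover empty_iff generic_points_meet_proj_hypersimplex)

lemma cell_perms_subsets:
  assumes "w \<in> cell_perms k m" "0 < k"
  shows "cell_subsets m w \<subseteq> k_subsets k (Suc m)"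
  using assms cell_subsets_subset_k_subsets[of w m] by (auto simp: cell_perms_iff)

lemma hypersimplex_subset:
  "hypersimplex k (Suc m) \<subseteq> {x \<in> coord_space (Suc m). z_coord x (Suc m) = real k}"
proof -
  have "{x \<in> coord_space (Suc m). z_coord x (Suc m) = real k} =
      coord_space (Suc m) \<inter> (\<lambda>x. z_coord x (Suc m)) -` {real k}"
    by auto
  then have "convex {x \<in> coord_space (Suc m). z_coord x (Suc m) = real k}"
    by (simp add: convex_Int convex_linear_vimage linear_z_coord
        subspace_imp_convex[OF subspace_coord_space])
  moreover have "eps I \<in> {x \<in> coord_space (Suc m). z_coord x (Suc m) = real k}"
    if I: "I \<in> k_subsets k (Suc m)" for I
  proof -
    have "eps I \<in> coord_space (Suc m)"
      using I by (auto simp: k_subsets_def coord_space_def eps_def indicator_def)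
    then show ?thesis
      by (simp add: z_coord_eps_k_subset[OF I] card_upto_k_subset_top[OF I])
  qed
  ultimately show ?thesis
    unfolding hypersimplex_def by (intro hull_minimal) auto
qed

lemma inj_on_drop_last_coord: "inj_on (drop_last_coord (Suc m)) (hypersimplex k (Suc m))"
proof (rule inj_onI)
  fix x y assume xy: "x \<in> hypersimplex k (Suc m)" "y \<in> hypersimplex k (Suc m)"
    and eq: "drop_last_coord (Suc m) x = drop_last_coord (Suc m) y"
  show "x = y"
  proof (rule coord_space_eqI)
    show "x \<in> coord_space (Suc m)" "y \<in> coord_space (Suc m)"
      using hypersimplex_subset xy by auto
    have "z_coord x (Suc m) = real k" "z_coord y (Suc m) = real k"
      using hypersimplex_subset xy by auto
    moreover have "z_coord x i = z_coord y i" if "i \<le> m" for i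
      using z_coord_drop_last_coord[OF that] eq by metis
    ultimately show "z_coord x i = z_coord y i" if "i \<le> Suc m" for i
      using that by (cases "i = Suc m") simp_all
  qed
qed

lemma bij_betw_drop_last_coord:
  assumes k: "0 < k" "k \<le> m"
  shows "bij_betw (drop_last_coord (Suc m)) (hypersimplex k (Suc m)) (proj_hypersimplex k (Suc m))"
proof -
  have image: "drop_last_coord (Suc m) ` hypersimplex k (Suc m) =
      convex hull (proj_vertex m ` k_subsets k (Suc m))"
    unfolding hypersimplex_def by (rule convex_hull_proj_vertex)
  have "\<dots> = proj_hypersimplex k (Suc m)"
  proof
    show "convex hull (proj_vertex m ` k_subsets k (Suc m)) \<subseteq> proj_hypersimplex k (Suc m)"
      by (intro hull_minimal convex_proj_hypersimplex)
        (auto intro: proj_vertex_in_proj_hypersimplex)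
    show "proj_hypersimplex k (Suc m) \<subseteq> convex hull (proj_vertex m ` k_subsets k (Suc m))"
    proof
      fix x assume "x \<in> proj_hypersimplex k (Suc m)"
      then obtain w where w: "w \<in> cell_perms k m" "x \<in> closed_cell m w"
        using closed_cells_cover k by blast
      have "convex hull (proj_vertex m ` cell_subsets m w) \<subseteq>
          convex hull (proj_vertex m ` k_subsets k (Suc m))"
        by (intro hull_mono image_mono cell_perms_subsets w(1) k(1))
      then show "x \<in> convex hull (proj_vertex m ` k_subsets k (Suc m))"
        using w closed_cell_eq_hull[of w m] by (auto simp: cell_perms_def)
    qed
  qed
  then show ?thesis
    using inj_on_drop_last_coord image by (simp add: bij_betw_def)
qed

lemma closed_cells_eq_hulls:
  "closed_cell m ` cell_perms k m =
    (\<lambda>\<I>. drop_last_coord (Suc m) ` (convex hull (eps ` \<I>))) ` cell_subsets m ` cell_perms k m"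
  unfolding image_image convex_hull_proj_vertex
  by (rule image_cong) (simp_all add: cell_perms_def closed_cell_eq_hull)

subsection \<open>Sortable families\<close>

definition sortable :: "nat set \<Rightarrow> nat set \<Rightarrow> bool" where
  "sortable I J \<longleftrightarrow> sorted_pair I J \<or> sorted_pair J I"

lemma pairwise_sortable_sorted_collection:
  assumes "sorted_collection k n Is"
  shows "pairwise sortable (set Is)"
proof (rule pairwiseI)
  fix I J assume "I \<in> set Is" "J \<in> set Is" "I \<noteq> J"
  then obtain s t where "s < length Is" "t < length Is" "I = Is ! s" "J = Is ! t" "s \<noteq> t"
    by (metis in_set_conv_nth)
  then show "sortable I J"
    using assms by (cases s t rule: linorder_cases) (auto simp: sortable_def sorted_collection_def)
qed

lemma cell_height_diff_sorted_pair:
  assumes w: "w permutes {1..m}" and I: "I \<in> k_subsets k (Suc m)" and J: "J \<in> k_subsets k (Suc m)"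
    and "sorted_pair I J"
  shows "cell_height m w (proj_vertex m I) s - cell_height m w (proj_vertex m J) s \<in> {0..1}"
proof -
  have "card_upto J i \<le> card_upto I i" "card_upto I i \<le> card_upto J i + 1" for i
    using assms(4) sorted_pair_iff[OF finite_k_subset[OF I] finite_k_subset[OF J]] by auto
  from this[of "w s"] show ?thesis
    by (auto simp: cell_height_def z_coord_proj_vertex[OF I] z_coord_proj_vertex[OF J]
        permutes_interval_le_iff[OF w])
qed

lemma cell_coord_sortable:
  assumes w: "w permutes {1..m}" and I: "I \<in> k_subsets k (Suc m)" and J: "J \<in> k_subsets k (Suc m)"
    and "sortable I J"
  shows "cell_coord m w s (proj_vertex m I) \<le> cell_coord m w s (proj_vertex m J) + 1"
  using assms(4) unfolding sortable_def
proof
  assume "sorted_pair I J"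
  from cell_height_diff_sorted_pair[OF w I J this, of s]
    cell_height_diff_sorted_pair[OF w I J this, of "Suc s"]
  show ?thesis by (simp add: cell_coord_def)
next
  assume "sorted_pair J I"
  from cell_height_diff_sorted_pair[OF w J I this, of s]
    cell_height_diff_sorted_pair[OF w J I this, of "Suc s"]
  show ?thesis by (simp add: cell_coord_def)
qed

context
  fixes k m :: nat
  assumes k_pos: "0 < k" and k_le: "k \<le> m"
begin

lemma sortable_family_subset_cell_subsets:
  assumes sub: "\<I> \<subseteq> k_subsets k (Suc m)" and sortable: "pairwise sortable \<I>"
  obtains w where "w \<in> cell_perms k m" "\<I> \<subseteq> cell_subsets m w"
proof (cases "\<I> = {}")
  case True
  then show ?thesis
    using that cell_perms_nonempty[OF k_pos k_le] by blast
next
  case False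
  have fin: "finite \<I>"
    using sub finite_k_subsets by (rule finite_subset)
  then have card: "0 < card \<I>"
    using False by (simp add: card_gt_0_iff)
  define x where "x = (\<Sum>I\<in>\<I>. (1 / real (card \<I>)) *\<^sub>R proj_vertex m I)"
  have "x \<in> proj_hypersimplex k (Suc m)"
    unfolding x_def using sub fin card
    by (intro convex_sum convex_proj_hypersimplex) (auto intro: proj_vertex_in_proj_hypersimplex)
  then obtain w where w: "w \<in> cell_perms k m" "x \<in> closed_cell m w"
    by (rule closed_cells_cover[OF _ k_pos k_le])
  then have perm: "w permutes {1..m}" "Suc (cell_floor w m) = k"
    by (simp_all add: cell_perms_iff k_pos)
  have "0 \<le> cell_coord m w s (proj_vertex m I)" if "I \<in> \<I>" "s \<le> m" for I s
  proof (rule nonneg_if_sum_nonneg_of_close_Ints[OF fin that(1)])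
    have "cell_coord m w s x = (\<Sum>I\<in>\<I>. cell_coord m w s (proj_vertex m I)) / real (card \<I>)"
      using card
      by (simp add: x_def affine_functional_sum[OF affine_cell_coord] sum_divide_distrib)
    moreover have "0 \<le> cell_coord m w s x"
      using w(2) that(2) by (simp add: closed_cell_def closed_simplex_def)
    ultimately show "0 \<le> (\<Sum>I\<in>\<I>. cell_coord m w s (proj_vertex m I))"
      using card by (simp add: zero_le_divide_iff)
    fix J K assume "J \<in> \<I>" "K \<in> \<I>"
    then show "cell_coord m w s (proj_vertex m J) \<le> cell_coord m w s (proj_vertex m K) + 1"
      using sub sortable cell_coord_sortable[OF perm(1), of J k K s]
      by (cases "J = K") (auto dest: pairwiseD)
  qed (use sub perm(1) in \<open>auto intro: cell_coord_proj_vertex_in_Ints\<close>)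
  then have "proj_vertex m I \<in> closed_cell m w" if "I \<in> \<I>" for I
    using that by (simp add: closed_cell_def closed_simplex_def proj_vertex_in_coord_space)
  then have "\<I> \<subseteq> cell_subsets m w"
    using sub perm proj_vertex_in_closed_cellD[of w m] by blast
  then show ?thesis using that w(1) by blast
qed

lemma card_sortable_family_le:
  assumes "\<I> \<subseteq> k_subsets k (Suc m)" "pairwise sortable \<I>"
  shows "card \<I> \<le> Suc m"
proof -
  obtain w where "w \<in> cell_perms k m" "\<I> \<subseteq> cell_subsets m w"
    using assms by (rule sortable_family_subset_cell_subsets)
  then show ?thesis
    using card_mono[OF finite_cell_subsets, of w m \<I>] card_cell_subsets[of w m]
    by (simp add: cell_perms_def)
qed

lemma sortable_family_of_full_card:
  assumes "\<I> \<subseteq> k_subsets k (Suc m)" "pairwise sortable \<I>" "card \<I> = Suc m"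
  obtains w where "w \<in> cell_perms k m" "\<I> = cell_subsets m w"
proof -
  obtain w where w: "w \<in> cell_perms k m" "\<I> \<subseteq> cell_subsets m w"
    using assms(1,2) by (rule sortable_family_subset_cell_subsets)
  then have "w permutes {1..m}"
    by (simp add: cell_perms_def)
  then have "\<I> = cell_subsets m w"
    using w(2) assms(3) by (intro card_seteq) (simp_all add: finite_cell_subsets card_cell_subsets)
  then show ?thesis using that w(1) by blast
qed

lemma sorted_collection_cell_subsets:
  assumes w: "w \<in> cell_perms k m"
  obtains Is where "sorted_collection k (Suc m) Is" "set Is = cell_subsets m w"
proof
  have perm: "w permutes {1..m}"
    using w by (simp add: cell_perms_def)
  have mem: "cell_subset m w s \<in> k_subsets k (Suc m)" if "s \<le> m" for s
    using cell_perms_subsets[OF w k_pos] that by (auto simp: cell_subsets_def)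
  show "set (map (cell_subset m w) [0..<Suc m]) = cell_subsets m w"
    by (auto simp: cell_subsets_def simp del: upt_Suc)
  have "sorted_pair (cell_subset m w s) (cell_subset m w t)" if "s < t" "t \<le> m" for s t
    using that mem[of s] mem[of t]
    by (auto simp: sorted_pair_k_subsets_iff card_upto_cell_subset[OF perm] vertex_sum_def)
  moreover have "distinct (map (cell_subset m w) [0..<Suc m])"
    using inj_on_cell_subset[OF perm]
    by (simp add: distinct_map atLeast0LessThan lessThan_Suc_atMost del: upt_Suc)
  ultimately show "sorted_collection k (Suc m) (map (cell_subset m w) [0..<Suc m])"
    using mem by (auto simp: sorted_collection_def simp del: upt_Suc)
qed

lemma maximal_sorted_collections_eq:
  "{set Is |Is. maximal_sorted_collection k (Suc m) Is} = cell_subsets m ` cell_perms k m"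
proof (intro equalityI subsetI)
  fix \<I> assume "\<I> \<in> {set Is |Is. maximal_sorted_collection k (Suc m) Is}"
  then obtain Is where Is: "maximal_sorted_collection k (Suc m) Is" "\<I> = set Is"
    by blast
  then have "\<I> \<subseteq> k_subsets k (Suc m)" "pairwise sortable \<I>"
    using pairwise_sortable_sorted_collection
    by (auto simp: maximal_sorted_collection_def sorted_collection_def)
  then obtain w where w: "w \<in> cell_perms k m" "\<I> \<subseteq> cell_subsets m w"
    by (rule sortable_family_subset_cell_subsets)
  obtain Js where Js: "sorted_collection k (Suc m) Js" "set Js = cell_subsets m w"
    using w(1) by (rule sorted_collection_cell_subsets)
  have "\<I> = cell_subsets m w"
    using Is w(2) Js unfolding maximal_sorted_collection_def by (metis psubsetI)
  then show "\<I> \<in> cell_subsets m ` cell_perms k m"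
    using w(1) by blast
next
  fix \<I> assume "\<I> \<in> cell_subsets m ` cell_perms k m"
  then obtain w where w: "w \<in> cell_perms k m" "\<I> = cell_subsets m w" by blast
  obtain Is where Is: "sorted_collection k (Suc m) Is" "set Is = cell_subsets m w"
    using w(1) by (rule sorted_collection_cell_subsets)
  have "\<not> set Is \<subset> set Js" if Js: "sorted_collection k (Suc m) Js" for Js
  proof
    assume "set Is \<subset> set Js"
    then have "card (set Is) < card (set Js)"
      by (intro psubset_card_mono) auto
    moreover have "card (set Is) = Suc m"
      using w(1) Is(2) by (simp add: card_cell_subsets cell_perms_def)
    moreover have "card (set Js) \<le> Suc m"
      using Js pairwise_sortable_sorted_collection
      by (intro card_sortable_family_le) (auto simp: sorted_collection_def)
    ultimately show False by simp
  qed
  then show "\<I> \<in> {set Is |Is. maximal_sorted_collection k (Suc m) Is}"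
    using Is w(2) unfolding maximal_sorted_collection_def by blast
qed

lemma sturmfels_simplices_eq: "sturmfels_simplices k (Suc m) = closed_cell m ` cell_perms k m"
  unfolding closed_cells_eq_hulls maximal_sorted_collections_eq[symmetric] sturmfels_simplices_def
  by blast

end

subsection \<open>Circuits\<close>

lemma circuit_graph_simps [simp]:
  "tail (circuit_graph k n) = fst" "head (circuit_graph k n) = snd \<circ> snd"
  "verts (circuit_graph k n) = eps ` k_subsets k n"
  by (simp_all add: circuit_graph_def fun_eq_iff split_beta)

lemma circuit_arc_iff:
  "(e, i, e') \<in> arcs (circuit_graph k n) \<longleftrightarrow>
    e \<in> eps ` k_subsets k n \<and> i \<in> {1..n} \<and> e i = 1 \<and> e (cyc_succ n i) = 0 \<and>
    e' = e(i := 0, cyc_succ n i := 1)"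
  by (auto simp: circuit_graph_def)

lemma z_coord_fun_upd:
  "z_coord (x(p := a)) j = z_coord x j + (if 1 \<le> p \<and> p \<le> j then a - x p else 0)"
  by (induction j) (auto simp: z_coord_Suc le_Suc_eq)

lemma circuit_arc_z_coord:
  assumes "(e, i, e') \<in> arcs (circuit_graph k (Suc m))" "j \<in> {1..m}"
  shows "z_coord e' j = z_coord e j - of_bool (i = j) + of_bool (i = Suc m)"
proof -
  have "i \<in> {1..Suc m}" "e i = 1" "e (cyc_succ (Suc m) i) = 0"
    "e' = e(i := 0, cyc_succ (Suc m) i := 1)"
    using assms(1) by (auto simp: circuit_arc_iff)
  then show ?thesis
    using assms(2) by (cases "i = Suc m") (auto simp: z_coord_fun_upd cyc_succ_def)
qed

lemma circuit_arc_of_swap: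
  assumes I: "I \<in> k_subsets k n" and i: "i \<in> I" "cyc_succ n i \<notin> I"
  defines "J \<equiv> insert (cyc_succ n i) (I - {i})"
  shows "J \<in> k_subsets k n" "(eps I, i, eps J) \<in> arcs (circuit_graph k n)"
proof -
  have sub: "I \<subseteq> {1..n}" "card I = k" "finite I"
    using I finite_k_subset[OF I] by (simp_all add: k_subsets_def)
  have "card J = card I"
    using i card_Suc_Diff1[OF sub(3) i(1)] sub(3) by (simp add: J_def)
  then show "J \<in> k_subsets k n"
    using sub i by (auto simp: J_def k_subsets_def cyc_succ_def)
  have "eps J = (eps I)(i := 0, cyc_succ n i := 1)"
    using i by (auto simp: J_def eps_def indicator_def fun_eq_iff)
  then show "(eps I, i, eps J) \<in> arcs (circuit_graph k n)"
    using I i sub by (auto simp: circuit_arc_iff eps_def)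
qed

lemma swap_positions_of_card_upto_step:
  assumes I: "I \<in> k_subsets k (Suc m)" and J: "J \<in> k_subsets k (Suc m)"
    and i: "i \<in> {1..Suc m}" and "1 \<le> m"
    and step: "\<forall>j\<in>{1..m}. card_upto J j + of_bool (i = j) = card_upto I j + of_bool (i = Suc m)"
  shows "i \<in> I" "cyc_succ (Suc m) i \<notin> I"
proof -
  have ends: "card_upto I 0 = 0" "card_upto J 0 = 0"
      "card_upto I (Suc m) = k" "card_upto J (Suc m) = k"
    using I J by (simp_all add: card_upto_k_subset_0 card_upto_k_subset_top)
  have "i \<in> I \<and> cyc_succ (Suc m) i \<notin> I"
  proof (cases "i = Suc m")
    case True
    have "card_upto J 1 = card_upto I 1 + 1" "card_upto J m = card_upto I m + 1"
      using step True \<open>1 \<le> m\<close> by auto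
    then show ?thesis
      using ends True card_upto_Suc[of J 0] card_upto_Suc[of I 0]
        card_upto_Suc[of J m] card_upto_Suc[of I m]
      by (auto simp: cyc_succ_def of_bool_def split: if_splits)
  next
    case False
    then obtain i' where i': "i = Suc i'" "i' < m"
      using i by (cases i) auto
    have "card_upto J i' = card_upto I i'"
      using bspec[OF step, of i'] ends i' by (cases "i' = 0") simp_all
    moreover have "card_upto J (Suc i') + 1 = card_upto I (Suc i')"
      using bspec[OF step, of i] i' by simp
    moreover have "card_upto J (Suc i) = card_upto I (Suc i)"
      using bspec[OF step, of "Suc i"] ends i' by (cases "i = m") simp_all
    ultimately show ?thesis
      using False i' card_upto_Suc[of J i'] card_upto_Suc[of I i']
        card_upto_Suc[of J i] card_upto_Suc[of I i]
      by (auto simp: cyc_succ_def of_bool_def split: if_splits)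
  qed
  then show "i \<in> I" "cyc_succ (Suc m) i \<notin> I" by blast+
qed

lemma circuit_arc_card_upto_iff:
  assumes I: "I \<in> k_subsets k (Suc m)" and J: "J \<in> k_subsets k (Suc m)"
    and i: "i \<in> {1..Suc m}" and "1 \<le> m"
  shows "(eps I, i, eps J) \<in> arcs (circuit_graph k (Suc m)) \<longleftrightarrow>
    (\<forall>j\<in>{1..m}. card_upto J j + of_bool (i = j) = card_upto I j + of_bool (i = Suc m))"
    (is "?arc \<longleftrightarrow> ?step J")
proof -
  have step: "?step J'" if "(eps I, i, eps J') \<in> arcs (circuit_graph k (Suc m))"
    "J' \<in> k_subsets k (Suc m)" for J'
  proof
    fix j assume j: "j \<in> {1..m}"
    have "real (card_upto J' j + of_bool (i = j)) = real (card_upto I j + of_bool (i = Suc m))"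
      using circuit_arc_z_coord[OF that(1) j]
      by (simp add: z_coord_eps_k_subset[OF I] z_coord_eps_k_subset[OF that(2)])
    then show "card_upto J' j + of_bool (i = j) = card_upto I j + of_bool (i = Suc m)"
      by (simp only: of_nat_eq_iff)
  qed
  show ?thesis
  proof
    assume J_step: "?step J"
    note swap =
      circuit_arc_of_swap[OF I swap_positions_of_card_upto_step[OF I J i assms(4) J_step]]
    have "insert (cyc_succ (Suc m) i) (I - {i}) = J"
      using step[OF swap(2,1)] J_step by (intro k_subset_eqI[OF swap(1) J]) force
    then show ?arc
      using swap(2) by simp
  qed (use step J in blast)
qed

definition labels :: "labelled_arc list \<Rightarrow> nat list" where
  "labels p = map (\<lambda>a. fst (snd a)) p"

lemma set_labels_subset: "set p \<subseteq> arcs (circuit_graph k n) \<Longrightarrow> set (labels p) \<subseteq> {1..n}"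
  by (force simp: labels_def circuit_graph_def)

lemma circuit_walk_z_coord:
  assumes "pre_digraph.cas (circuit_graph k (Suc m)) e p e'"
    and "set p \<subseteq> arcs (circuit_graph k (Suc m))" and j: "j \<in> {1..m}"
  shows "z_coord e' j + real (count_list (labels p) j) =
    z_coord e j + real (count_list (labels p) (Suc m))"
  using assms(1,2)
proof (induction p arbitrary: e)
  case Nil
  then show ?case by (simp add: pre_digraph.cas.simps labels_def)
next
  case (Cons a p)
  obtain e0 i e1 where a: "a = (e0, i, e1)" by (cases a)
  have "e0 = e" "pre_digraph.cas (circuit_graph k (Suc m)) e1 p e'"
    using Cons.prems(1) by (simp_all add: pre_digraph.cas.simps a)
  moreover have "(e0, i, e1) \<in> arcs (circuit_graph k (Suc m))"
    using Cons.prems(2) a by simp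
  ultimately show ?case
    using Cons.IH[of e1] Cons.prems(2) circuit_arc_z_coord[OF _ j, of e0 i e1 k]
    by (auto simp: labels_def a)
qed

text \<open>Every partial sum returns to its initial value along a closed walk.\<close>

lemma closed_walk_count_labels:
  assumes "pre_digraph.cas (circuit_graph k (Suc m)) e c e"
    and "set c \<subseteq> arcs (circuit_graph k (Suc m))" and "j \<in> {1..Suc m}"
  shows "count_list (labels c) j = count_list (labels c) (Suc m)"
  using circuit_walk_z_coord[OF assms(1,2), of j] assms(3) by (cases "j = Suc m") auto

lemma length_closed_walk:
  assumes "pre_digraph.cas (circuit_graph k (Suc m)) e c e"
    and "set c \<subseteq> arcs (circuit_graph k (Suc m))"
  shows "length c = Suc m * count_list (labels c) (Suc m)"
proof -
  have "length c = (\<Sum>j\<in>{1..Suc m}. count_list (labels c) j)"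
    using sum_count_set[OF set_labels_subset[OF assms(2)]] by (simp add: labels_def)
  also have "\<dots> = (\<Sum>j\<in>{1..Suc m}. count_list (labels c) (Suc m))"
    by (rule sum.cong[OF refl closed_walk_count_labels[OF assms]])
  finally show ?thesis by simp
qed

lemma distinct_walk_sortable:
  assumes walk: "pre_digraph.cas (circuit_graph k (Suc m)) (eps I) p (eps J)"
      "set p \<subseteq> arcs (circuit_graph k (Suc m))"
    and I: "I \<in> k_subsets k (Suc m)" and J: "J \<in> k_subsets k (Suc m)"
    and "distinct (labels p)"
  shows "sortable I J"
proof -
  have count: "count_list (labels p) j \<le> 1" for j
    using assms(5) by (simp add: distinct_count_atmost_1 flip: count_mset)
  have step: "card_upto J j + count_list (labels p) j =
      card_upto I j + count_list (labels p) (Suc m)" if "j \<in> {1..m}" for j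
  proof -
    have "real (card_upto J j + count_list (labels p) j) =
        real (card_upto I j + count_list (labels p) (Suc m))"
      using circuit_walk_z_coord[OF walk that]
      by (simp add: z_coord_eps_k_subset[OF I] z_coord_eps_k_subset[OF J])
    then show ?thesis by (simp only: of_nat_eq_iff)
  qed
  show ?thesis
  proof (cases "Suc m \<in> set (labels p)")
    case True
    then have "count_list (labels p) (Suc m) = 1"
      using count[of "Suc m"] count_list_0_iff[of "labels p" "Suc m"] by linarith
    then have "card_upto I j \<le> card_upto J j \<and> card_upto J j \<le> card_upto I j + 1"
      if "j \<in> {1..m}" for j
      using step[OF that] count[of j] by simp
    then show ?thesis
      by (simp add: sortable_def sorted_pair_k_subsets_iff[OF J I])
  next
    case False
    then have "card_upto J j \<le> card_upto I j \<and> card_upto I j \<le> card_upto J j + 1"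
      if "j \<in> {1..m}" for j
      using step[OF that] count[of j] by simp
    then show ?thesis
      by (simp add: sortable_def sorted_pair_k_subsets_iff[OF I J])
  qed
qed

lemma length_cycle_ge:
  assumes "pre_digraph.cycle (circuit_graph k (Suc m)) c"
  shows "Suc m \<le> length c"
proof -
  obtain e where "pre_digraph.cas (circuit_graph k (Suc m)) e c e"
      "set c \<subseteq> arcs (circuit_graph k (Suc m))" "c \<noteq> []"
    using assms by (auto simp: pre_digraph.cycle_def pre_digraph.awalk_def)
  then have "length c = Suc m * count_list (labels c) (Suc m)" "length c \<noteq> 0"
    using length_closed_walk by blast+
  then show ?thesis by (cases "count_list (labels c) (Suc m)") auto
qed

context
  fixes k m :: nat and e :: "nat \<Rightarrow> real" and c :: "labelled_arc list"
  assumes closed: "pre_digraph.cas (circuit_graph k (Suc m)) e c e"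
    and arcs: "set c \<subseteq> arcs (circuit_graph k (Suc m))"
    and len: "length c = Suc m"
begin

lemma distinct_labels_closed_walk: "distinct (labels c)"
proof -
  have "count_list (labels c) (Suc m) = 1"
    using length_closed_walk[OF closed arcs] len by (metis mult_eq_self_implies_10 nat.distinct(2))
  then have "{1..Suc m} \<subseteq> set (labels c)"
    using closed_walk_count_labels[OF closed arcs] by (metis count_notin subsetI zero_neq_one)
  then have "set (labels c) = {1..Suc m}"
    using set_labels_subset[OF arcs] by blast
  then show ?thesis
    using len by (intro card_distinct) (simp add: labels_def)
qed

lemma closed_walk_sortable_nth:
  assumes "s \<le> t" "t < length c" "fst (c ! s) = eps I" "fst (c ! t) = eps J"
    and "I \<in> k_subsets k (Suc m)" "J \<in> k_subsets k (Suc m)"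
  shows "sortable I J"
proof (rule distinct_walk_sortable)
  let ?p = "take (t - s) (drop s c)"
  show "pre_digraph.cas (circuit_graph k (Suc m)) (eps I) ?p (eps J)"
    using pre_digraph.cas_between[OF closed assms(1,2)] assms(3,4) by simp
  show "set ?p \<subseteq> arcs (circuit_graph k (Suc m))"
    using arcs set_take_subset set_drop_subset by fast
  have "labels ?p = take (t - s) (drop s (labels c))"
    by (simp add: labels_def take_map drop_map)
  then show "distinct (labels ?p)"
    using distinct_labels_closed_walk by (simp add: distinct_take distinct_drop)
qed (use assms in auto)

lemma closed_walk_sortable:
  assumes "eps I \<in> fst ` set c" "eps J \<in> fst ` set c"
    and "I \<in> k_subsets k (Suc m)" "J \<in> k_subsets k (Suc m)"
  shows "sortable I J"
proof -
  obtain s t where st: "s < length c" "fst (c ! s) = eps I" "t < length c" "fst (c ! t) = eps J"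
    using assms(1,2) by (auto simp: in_set_conv_nth simp flip: set_map)
  show ?thesis
  proof (cases "s \<le> t")
    case True
    then show ?thesis
      using st assms(3,4) by (intro closed_walk_sortable_nth)
  next
    case False
    then have "sortable J I"
      using st assms(3,4) by (intro closed_walk_sortable_nth[of t s]) simp_all
    then show ?thesis
      by (auto simp: sortable_def)
  qed
qed

end

lemma vertex_sum_Suc:
  assumes "w permutes S"
  shows "vertex_sum w (Suc s) j + of_bool (w (Suc s) = j) = vertex_sum w s j"
proof -
  have "w (Suc s) = j \<longleftrightarrow> inv w j = Suc s"
    using permutes_inverses[OF assms] by metis
  then show ?thesis
    by (auto simp: vertex_sum_def)
qed

lemma vertex_sum_first_last:
  assumes w: "w permutes {1..m}" and "j \<in> {1..m}"
  shows "vertex_sum w 0 j = vertex_sum w m j + 1"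
proof -
  have "inv w j \<in> {1..m}"
    using permutes_in_image[OF permutes_inv[OF w]] assms(2) by simp
  then show ?thesis
    by (simp add: vertex_sum_def)
qed

lemma inj_eps: "inj eps"
  by (rule inj_on_inverseI[where g = "\<lambda>e. {i. e i = 1}"]) (simp add: eps_def indicator_eq_1_iff)

definition cell_circuit :: "nat \<Rightarrow> (nat \<Rightarrow> nat) \<Rightarrow> labelled_arc list" where
  "cell_circuit m w = map (\<lambda>s. (eps (cell_subset m w (s mod Suc m)), w (Suc s),
     eps (cell_subset m w (Suc s mod Suc m)))) [0..<Suc m]"

lemma map_fst_cell_circuit:
  "map fst (cell_circuit m w) = map (\<lambda>s. eps (cell_subset m w s)) [0..<Suc m]"
  by (simp add: cell_circuit_def)

lemma fst_set_cell_circuit: "fst ` set (cell_circuit m w) = eps ` cell_subsets m w"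
  using arg_cong[OF map_fst_cell_circuit, of set]
  by (simp add: cell_subsets_def image_image atLeast0LessThan lessThan_Suc_atMost del: upt_Suc)

context
  fixes k m :: nat
  assumes k_pos: "0 < k" and k_le: "k \<le> m"
begin

lemma set_cell_circuit_subset_arcs:
  assumes w: "w \<in> cell_perms k m"
  shows "set (cell_circuit m w) \<subseteq> arcs (circuit_graph k (Suc m))"
proof -
  have perm: "w permutes {1..m}"
    using w by (simp add: cell_perms_def)
  define I where "I s = cell_subset m w (s mod Suc m)" for s
  have I: "I s \<in> k_subsets k (Suc m)" for s
    using cell_perms_subsets[OF w k_pos]
    by (auto simp: I_def cell_subsets_def less_Suc_eq_le[symmetric])
  have card_I: "card_upto (I s) j = vertex_sum w (s mod Suc m) j" if "j \<in> {1..m}" for s j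
    using card_upto_cell_subset[OF perm] that by (simp add: I_def)
  have "(eps (I s), w (Suc s), eps (I (Suc s))) \<in> arcs (circuit_graph k (Suc m))" if "s \<le> m" for s
  proof -
    have "card_upto (I (Suc s)) j + of_bool (w (Suc s) = j) =
        card_upto (I s) j + of_bool (w (Suc s) = Suc m)" if j: "j \<in> {1..m}" for j
    proof (cases "s = m")
      case True
      then show ?thesis
        using j by (simp add: card_I vertex_sum_first_last[OF perm] permutes_interval_Suc[OF perm])
    next
      case False
      moreover have "w (Suc s) \<le> m"
        using False \<open>s \<le> m\<close> by (simp add: permutes_interval_le_iff[OF perm])
      ultimately show ?thesis
        using j \<open>s \<le> m\<close> by (simp add: card_I vertex_sum_Suc[OF perm])
    qed
    moreover have "w (Suc s) \<in> {1..Suc m}"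
      using permutes_in_image[OF permutes_subset[OF perm], of "{1..Suc m}" "Suc s"] \<open>s \<le> m\<close> by simp
    ultimately show ?thesis
      using I k_pos k_le by (subst circuit_arc_card_upto_iff) auto
  qed
  then show ?thesis
    by (auto simp: cell_circuit_def I_def simp del: upt_Suc)
qed

lemma cycle_cell_circuit:
  assumes w: "w \<in> cell_perms k m"
  shows "pre_digraph.cycle (circuit_graph k (Suc m)) (cell_circuit m w)"
  unfolding pre_digraph.cycle_iff_distinct_tails
proof (intro conjI exI)
  let ?f = "\<lambda>s. eps (cell_subset m w (s mod Suc m))"
  have perm: "w permutes {1..m}"
    using w by (simp add: cell_perms_def)
  show "cell_circuit m w \<noteq> []"
    by (simp add: cell_circuit_def)
  have "pre_digraph.cas (circuit_graph k (Suc m)) (?f 0) (cell_circuit m w) (?f (Suc m))"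
    unfolding cell_circuit_def by (rule pre_digraph.cas_map_upt[where f = ?f]) simp_all
  moreover have "cell_subset m w 0 \<in> k_subsets k (Suc m)"
    using cell_perms_subsets[OF w k_pos] by (auto simp: cell_subsets_def)
  ultimately show "pre_digraph.awalk (circuit_graph k (Suc m)) (?f 0) (cell_circuit m w) (?f 0)"
    using set_cell_circuit_subset_arcs[OF w] by (simp add: pre_digraph.awalk_def)
  have "inj_on (\<lambda>s. eps (cell_subset m w s)) {..m}"
    using comp_inj_on[OF inj_on_cell_subset[OF perm] inj_on_subset[OF inj_eps]]
    by (simp add: o_def)
  then show "distinct (map (tail (circuit_graph k (Suc m))) (cell_circuit m w))"
    by (simp add: map_fst_cell_circuit distinct_map atLeast0LessThan lessThan_Suc_atMost
        del: upt_Suc)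
qed

lemma minimal_circuit_iff:
  "minimal_circuit k (Suc m) c \<longleftrightarrow>
    pre_digraph.cycle (circuit_graph k (Suc m)) c \<and> length c = Suc m"
proof -
  obtain w where w: "w \<in> cell_perms k m"
    using cell_perms_nonempty[OF k_pos k_le] by blast
  have "length (cell_circuit m w) = Suc m"
    by (simp add: cell_circuit_def)
  then show ?thesis
    using cycle_cell_circuit[OF w] length_cycle_ge[of k m]
    unfolding minimal_circuit_def is_arg_min_linorder by (metis le_antisym)
qed

lemma minimal_circuit_tails:
  assumes "minimal_circuit k (Suc m) c"
  obtains w where "w \<in> cell_perms k m" "fst ` set c = eps ` cell_subsets m w"
proof -
  have cycle: "pre_digraph.cycle (circuit_graph k (Suc m)) c" and len: "length c = Suc m"
    using assms by (simp_all add: minimal_circuit_iff)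
  obtain e where c: "pre_digraph.cas (circuit_graph k (Suc m)) e c e"
      "set c \<subseteq> arcs (circuit_graph k (Suc m))"
    using cycle by (auto simp: pre_digraph.cycle_def pre_digraph.awalk_def)
  define V \<I> where "V = fst ` set c" and "\<I> = {I \<in> k_subsets k (Suc m). eps I \<in> V}"
  have "V \<subseteq> eps ` k_subsets k (Suc m)"
    using c(2) by (auto simp: V_def circuit_arc_iff)
  then have tails: "V = eps ` \<I>"
    by (auto simp: \<I>_def)
  have "distinct (map fst c)"
    using cycle by (simp add: pre_digraph.cycle_iff_distinct_tails)
  then have "card V = Suc m"
    using distinct_card[of "map fst c"] len by (simp add: V_def)
  then have "card \<I> = Suc m"
    using tails by (simp add: card_image[OF inj_on_subset[OF inj_eps]])
  moreover have "pairwise sortable \<I>"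
    using closed_walk_sortable[OF c len] by (auto simp: \<I>_def V_def intro: pairwiseI)
  moreover have "\<I> \<subseteq> k_subsets k (Suc m)"
    by (auto simp: \<I>_def)
  ultimately obtain w where "w \<in> cell_perms k m" "\<I> = cell_subsets m w"
    using sortable_family_of_full_card[OF k_pos k_le] by blast
  then show ?thesis using that tails by (simp add: V_def)
qed

lemma minimal_circuit_tails_eq:
  "{tail (circuit_graph k (Suc m)) ` set c |c. minimal_circuit k (Suc m) c} =
    (`) eps ` cell_subsets m ` cell_perms k m"
proof (intro equalityI subsetI)
  fix V assume "V \<in> {tail (circuit_graph k (Suc m)) ` set c |c. minimal_circuit k (Suc m) c}"
  then obtain c where c: "minimal_circuit k (Suc m) c" "V = fst ` set c"
    by auto
  then obtain w where "w \<in> cell_perms k m" "V = eps ` cell_subsets m w"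
    by (metis minimal_circuit_tails)
  then show "V \<in> (`) eps ` cell_subsets m ` cell_perms k m"
    by blast
next
  fix V assume "V \<in> (`) eps ` cell_subsets m ` cell_perms k m"
  then obtain w where w: "w \<in> cell_perms k m" "V = fst ` set (cell_circuit m w)"
    by (auto simp: fst_set_cell_circuit)
  then have "minimal_circuit k (Suc m) (cell_circuit m w)"
    by (simp add: minimal_circuit_iff cycle_cell_circuit) (simp add: cell_circuit_def)
  then show "V \<in> {tail (circuit_graph k (Suc m)) ` set c |c. minimal_circuit k (Suc m) c}"
    using w(2) by auto
qed

lemma circuit_simplices_eq: "circuit_simplices k (Suc m) = closed_cell m ` cell_perms k m"
proof -
  have "circuit_simplices k (Suc m) = (\<lambda>V. drop_last_coord (Suc m) ` (convex hull V)) `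
      {tail (circuit_graph k (Suc m)) ` set c |c. minimal_circuit k (Suc m) c}"
    unfolding circuit_simplices_def by blast
  then show ?thesis
    unfolding minimal_circuit_tails_eq closed_cells_eq_hulls
    by (simp only: image_image)
qed

end

theorem theorem2p7:
  fixes k n :: nat
  assumes "0 < k" and "k < n"
  shows "linear (drop_last_coord n)
    \<and> bij_betw (drop_last_coord n) (hypersimplex k n) (proj_hypersimplex k n)
    \<and> (\<forall>S \<in> stanley_simplices k n. is_simplex (n - 1) S \<and> S \<subseteq> proj_hypersimplex k n)
    \<and> stanley_simplices k n = sturmfels_simplices k n
    \<and> sturmfels_simplices k n = alcove_simplices k n
    \<and> alcove_simplices k n = circuit_simplices k n"
proof -
  obtain m where n: "n = Suc m" and k: "0 < k" "k \<le> m" and m: "1 \<le> m"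
    using assms by (cases n) auto
  have "is_simplex m S \<and> S \<subseteq> proj_hypersimplex k (Suc m)"
    if "S \<in> closed_cell m ` cell_perms k m" for S
    using that k(1) is_simplex_closed_cell closed_cell_subset_proj_hypersimplex
    by (force simp: cell_perms_iff)
  then show ?thesis
    unfolding n stanley_simplices_eq[OF m] sturmfels_simplices_eq[OF k]
      alcove_simplices_eq[OF m k(1)] circuit_simplices_eq[OF k]
    using linear_drop_last_coord bij_betw_drop_last_coord[OF k] by simp
qed

end
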